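(* Let $(X(s),W(s))^T$ be a zero-mean stationary bivariate Gaussian random field on $\mathbb R$ with matrix covariance function $(K_{k\ell})$, each $K_{k\ell}$ satisfying condition $\mathrm A(L,c_{k\ell},\alpha_{k\ell})$ (defined in the context) for some $L>0$, with $c_{12}\ne0$, $\alpha_{12}>\alpha_{11}$ and $\alpha_{11}<\alpha_{22}+1$. Let $X$ and $Y=X\beta+W$ be observed at the grid points $s_i=ih$ with $h=L/n$, $0\le i\le n$. Let $\Sigma$ be the $(n+1)\times(n+1)$ matrix $$\Sigma_{ij}=\exp(-\lambda|s_i-s_j|),\qquad\lambda>0.$$ If $\alpha_{11}>2$, then there is a set $S\subseteq(0,\infty)$ with $|S|\le12$ such that for all $\lambda\in(0,\infty)\setminus S$ the generalized least squares estimator based on the working covariance matrix $\Sigma$, $$\hat\beta_{GLS}=\frac{X^T\Sigma^{-1}Y}{X^T\Sigma^{-1}X},$$ is inconsistent for $\beta$.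
   Context: Condition $\mathrm A(L,c,\alpha)$: $K(t)=A(t)+B(t)$, where $A$ is even and analytic and $B$ is even and continuous on $[-L,L]$; the $k$-th derivative $B^{(k)}$ on $(0,L]$ ($k\ge0$, $B^{(0)}=B$) satisfies, as $t\downarrow0$, $B^{(k)}(t)=(\alpha)_k\,c\,t^{\alpha-k}+o(t^{\alpha-k})$, where $c$ is a constant (non-zero for covariance functions), $\alpha>0$ is not an even integer, $(\alpha)_k=\Gamma(\alpha+1)/\Gamma(\alpha+1-k)$. Index $1$ refers to $X$, $2$ to $W$. In the formula for $\hat\beta_{GLS}$, $X$ and $Y$ denote the vectors $(X(s_0),\dots,X(s_n))^T$ and $(Y(s_0),\dots,Y(s_n))^T$. Inconsistent means that $\hat\beta_{GLS}$ does not converge to $\beta$ in probability as $n\to\infty$. *)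

theory Defs
  imports "HOL-Probability.Probability" "Jordan_Normal_Form.Gauss_Jordan_Elimination"
begin

definition real_analytic_on :: "(real \<Rightarrow> real) \<Rightarrow> real set \<Rightarrow> bool" where
  "real_analytic_on f S \<longleftrightarrow> (\<forall>x\<in>S. \<exists>F. (\<lambda>h. f (x + h)) has_fps_expansion F)"

(* (alpha)_k = Gamma(alpha + 1) / Gamma(alpha + 1 - k).  At a pole of the denominator (alpha an
   integer with k > alpha) HOL has Gamma = 0 and x / 0 = 0, so the quotient is 0, which is the
   value given by reading 1 / Gamma as an entire function. *)
definition falling :: "real \<Rightarrow> nat \<Rightarrow> real" where
  "falling \<alpha> k = Gamma (\<alpha> + 1) / Gamma (\<alpha> + 1 - real k)"

(* Db k is the k-th derivative of B on (0, L], one-sided at L.  Analyticity of A on the closed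
   interval means analyticity at each of its points, i.e. on a neighbourhood of it. *)
definition cond_A :: "real \<Rightarrow> real \<Rightarrow> real \<Rightarrow> (real \<Rightarrow> real) \<Rightarrow> bool" where
  "cond_A L c \<alpha> K \<longleftrightarrow>
     \<alpha> > 0 \<and> (\<forall>m::nat. \<alpha> \<noteq> 2 * real m) \<and>
     (\<exists>A B (Db :: nat \<Rightarrow> real \<Rightarrow> real).
        (\<forall>t\<in>{-L..L}. K t = A t + B t) \<and>
        (\<forall>t\<in>{-L..L}. A (-t) = A t) \<and> real_analytic_on A {-L..L} \<and>
        (\<forall>t\<in>{-L..L}. B (-t) = B t) \<and> continuous_on {-L..L} B \<and>
        (\<forall>t\<in>{0<..L}. Db 0 t = B t) \<and>
        (\<forall>k. \<forall>t\<in>{0<..L}. (Db k has_real_derivative Db (Suc k) t) (at t within {0<..L})) \<and>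
        (\<forall>k. (\<lambda>t. Db k t - falling \<alpha> k * c * t powr (\<alpha> - real k))
               \<in> o[at_right 0](\<lambda>t. t powr (\<alpha> - real k))))"

(* Normal distributions of variance 0 are included. *)
definition gaussian_rv :: "'a measure \<Rightarrow> ('a \<Rightarrow> real) \<Rightarrow> bool" where
  "gaussian_rv M X \<longleftrightarrow> X \<in> borel_measurable M \<and>
     ((\<exists>\<mu> \<sigma>. \<sigma> > 0 \<and> distributed M lborel X (normal_density \<mu> \<sigma>)) \<or>
      (\<exists>\<mu>. AE \<omega> in M. X \<omega> = \<mu>))"

definition covar :: "'a measure \<Rightarrow> ('a \<Rightarrow> real) \<Rightarrow> ('a \<Rightarrow> real) \<Rightarrow> real" where
  "covar M X Y = (\<integral>\<omega>. (X \<omega> - (\<integral>\<omega>'. X \<omega>' \<partial>M)) * (Y \<omega> - (\<integral>\<omega>'. Y \<omega>' \<partial>M)) \<partial>M)"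

(* Z k is the k-th component of the field.  The finite-dimensional distributions are multivariate
   normal, i.e. every linear combination of finitely many values is normal; a Gaussian field is
   determined in law by its first two moments, so the last two clauses give stationarity. *)
definition stationary_gaussian_field ::
  "'a measure \<Rightarrow> ('k::finite \<Rightarrow> real \<Rightarrow> 'a \<Rightarrow> real) \<Rightarrow> ('k \<Rightarrow> 'k \<Rightarrow> real \<Rightarrow> real) \<Rightarrow> bool" where
  "stationary_gaussian_field M Z K \<longleftrightarrow>
     (\<forall>J a. finite J \<longrightarrow> gaussian_rv M (\<lambda>\<omega>. \<Sum>k\<in>UNIV. \<Sum>s\<in>J. a k s * Z k s \<omega>)) \<and>
     (\<forall>k s. (\<integral>\<omega>. Z k s \<omega> \<partial>M) = 0) \<and>
     (\<forall>k l s t. covar M (Z k s) (Z l (s + t)) = K k l t)"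

definition tendsto_in_prob :: "'a measure \<Rightarrow> (nat \<Rightarrow> 'a \<Rightarrow> real) \<Rightarrow> real \<Rightarrow> bool" where
  "tendsto_in_prob M T b \<longleftrightarrow>
     (\<forall>\<epsilon>>0. (\<lambda>n. measure M {\<omega> \<in> space M. \<bar>T n \<omega> - b\<bar> > \<epsilon>}) \<longlonglongrightarrow> 0)"

definition grid :: "real \<Rightarrow> nat \<Rightarrow> nat \<Rightarrow> real" where
  "grid L n i = real i * (L / real n)"

definition grid_vec :: "real \<Rightarrow> nat \<Rightarrow> (real \<Rightarrow> 'a \<Rightarrow> real) \<Rightarrow> 'a \<Rightarrow> real Matrix.vec" where
  "grid_vec L n X \<omega> = Matrix.vec (n + 1) (\<lambda>i. X (grid L n i) \<omega>)"

definition exp_cov_mat :: "real \<Rightarrow> nat \<Rightarrow> real \<Rightarrow> real mat" where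
  "exp_cov_mat L n lam =
     mat (n + 1) (n + 1) (\<lambda>(i, j). exp (- lam * \<bar>grid L n i - grid L n j\<bar>))"

definition gls :: "real mat \<Rightarrow> real Matrix.vec \<Rightarrow> real Matrix.vec \<Rightarrow> real" where
  "gls \<Sigma> x y = (let P = the (mat_inverse \<Sigma>) in
     scalar_prod x (P *\<^sub>v y) / scalar_prod x (P *\<^sub>v x))"

end

theory Submission
  imports Defs "HOL-Real_Asymp.Real_Asymp" "Jordan_Normal_Form.Determinant"
begin

text \<open>
  With \<open>r = exp (- \<lambda> h)\<close> the working covariance is the correlation of a stationary AR(1) sequence, so
  \<open>N = X\<^sup>T \<Sigma>\<^sup>-\<^sup>1 W\<close> satisfies \<open>(1 - r\<^sup>2) N = (1 - r)\<^sup>2 S + r D + r (1 - r) Q\<close>, where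
  \<open>S = \<Sum> X\<^sub>i W\<^sub>i\<close>, \<open>D = \<Sum> \<Delta>X\<^sub>i \<Delta>W\<^sub>i\<close> and \<open>Q = X(0) W(0) + X(L) W(L)\<close> do not depend on \<open>\<lambda>\<close>, and
  \<open>Q\<close> does not even depend on \<open>n\<close>.  As \<open>\<alpha>\<^sub>1\<^sub>1 > 2\<close>, the denominator \<open>X\<^sup>T \<Sigma>\<^sup>-\<^sup>1 X\<close> has bounded mean, so
  consistency at \<open>\<lambda>\<close> forces \<open>N \<rightarrow> 0\<close> in probability.  If this happened for three values of \<open>\<lambda>\<close>, the two
  sums \<open>S\<close> and \<open>D\<close> could be eliminated exactly, leaving \<open>Q = 0\<close> almost surely.  The Gaussian fourth
  moment formula then yields \<open>X(s + L) = \<epsilon> X(s)\<close> and \<open>W(s + L) = - \<epsilon> W(s)\<close> with \<open>\<epsilon> = \<plusminus>1\<close> (unless one of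
  the fields vanishes), so \<open>K\<^sub>1\<^sub>2 = - K\<^sub>1\<^sub>2 = 0\<close>; this contradicts \<open>c\<^sub>1\<^sub>2 \<noteq> 0\<close>, since \<open>\<alpha>\<^sub>1\<^sub>2\<close> is not an even
  integer.  Hence at most two exceptional values of \<open>\<lambda>\<close> exist.
\<close>

section \<open>Inverting the exponential covariance\<close>

text \<open>The bilinear form of the inverse of the matrix with entries r^|i-j|, the correlation of
  a stationary AR(1) sequence. One-step prediction errors are uncorrelated with variance 1 - r^2, so
  the form is diagonal in them.\<close>

definition ou_form :: "real \<Rightarrow> nat \<Rightarrow> (nat \<Rightarrow> real) \<Rightarrow> (nat \<Rightarrow> real) \<Rightarrow> real" where
  "ou_form r n x y = x 0 * y 0 +
     (\<Sum>i<n. (x (Suc i) - r * x i) * (y (Suc i) - r * y i)) / (1 - r\<^sup>2)"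

text \<open>A product of two prediction errors exceeds r times the product of increments by (1 - r)
  x_{i+1} y_{i+1} - r (1 - r) x_i y_i. Summing these terms gives (1 - r)^2 in the interior and an
  extra r (1 - r) at each end. The point of the form is that \<open>r\<close> enters only through
  the three coefficients.\<close>

lemma ou_form_decomposition:
  assumes "r\<^sup>2 \<noteq> 1"
  shows "(1 - r\<^sup>2) * ou_form r n x y =
    (1 - r)\<^sup>2 * (\<Sum>i\<le>n. x i * y i) + r * (\<Sum>i<n. (x (Suc i) - x i) * (y (Suc i) - y i)) +
    r * (1 - r) * (x 0 * y 0 + x n * y n)"
proof -
  have "(1 - r\<^sup>2) * ou_form r n x y =
    (1 - r\<^sup>2) * (x 0 * y 0) + (\<Sum>i<n. (x (Suc i) - r * x i) * (y (Suc i) - r * y i))"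
    using assms by (simp add: ou_form_def distrib_left)
  also have "\<dots> = (1 - r)\<^sup>2 * (\<Sum>i\<le>n. x i * y i) +
      r * (\<Sum>i<n. (x (Suc i) - x i) * (y (Suc i) - y i)) + r * (1 - r) * (x 0 * y 0 + x n * y n)"
    by (induction n) (simp_all add: algebra_simps power2_eq_square)
  finally show ?thesis .
qed

text \<open>Telescoping: the term with index \<open>i\<close> is
  \<open>r ^ (k - Suc i) * x (Suc i) - r ^ (k - i) * x i\<close>.\<close>

lemma sum_ar_residual: "(\<Sum>i<k. (x (Suc i) - r * x i) * r ^ (k - Suc i)) = x k - r ^ k * x 0"
  for x :: "nat \<Rightarrow> real"
proof (induction k)
  case (Suc k)
  have "(\<Sum>i<k. (x (Suc i) - r * x i) * r ^ (Suc k - Suc i)) =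
      r * (\<Sum>i<k. (x (Suc i) - r * x i) * r ^ (k - Suc i))"
    unfolding sum_distrib_left by (rule sum.cong) (auto simp: Suc_diff_Suc Suc_diff_le simp flip: power_Suc)
  then show ?case using Suc by (simp add: right_diff_distrib mult_ac)
qed simp

text \<open>With y = R z for the correlation matrix R, the prediction error of \<open>y\<close> at
  \<open>i\<close> involves only the \<open>z k\<close> with \<open>i < k\<close>. After swapping
  the sums, the coefficient of \<open>z k\<close> collects the errors of \<open>x\<close> below
  \<open>k\<close>, which telescope to \<open>x k - r ^ k * x 0\<close>; the term
  \<open>x 0 * y 0\<close> restores the missing part.\<close>

lemma ou_form_inverts_correlation:
  fixes x y z :: "nat \<Rightarrow> real"
  assumes r: "r\<^sup>2 \<noteq> 1"
    and y: "\<And>i. i \<le> n \<Longrightarrow> y i = (\<Sum>k\<le>n. r ^ ((i - k) + (k - i)) * z k)"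
  shows "ou_form r n x y = (\<Sum>k\<le>n. x k * z k)"
proof -
  \<comment> \<open>For k \<le> i the contributions cancel, as r^(i+1-k) = r * r^(i-k). For k > i,
    r^(k-i-1) - r * r^(k-i) produces the factor 1 - r^2 that the denominator of
    \<open>ou_form\<close> removes.\<close>
  have step: "y (Suc i) - r * y i = (1 - r\<^sup>2) * (\<Sum>k\<le>n. if i < k then r ^ (k - Suc i) * z k else 0)"
    if "i < n" for i
  proof -
    have "r ^ ((Suc i - k) + (k - Suc i)) * z k - r * (r ^ ((i - k) + (k - i)) * z k) =
        (1 - r\<^sup>2) * (if i < k then r ^ (k - Suc i) * z k else 0)" for k
    proof (cases "i < k")
      case True
      then obtain d where "k = Suc (i + d)" using less_imp_Suc_add by blast
      then show ?thesis by (simp add: algebra_simps power2_eq_square)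
    next
      case False
      then obtain d where "i = k + d" using le_Suc_ex not_less by blast
      then show ?thesis by (simp add: Suc_diff_le)
    qed
    then show ?thesis
      using that by (simp add: y sum_distrib_left flip: sum_subtractf)
  qed
  have "(\<Sum>i<n. (x (Suc i) - r * x i) * (y (Suc i) - r * y i)) / (1 - r\<^sup>2) =
      (\<Sum>i<n. \<Sum>k\<le>n. if i < k then (x (Suc i) - r * x i) * r ^ (k - Suc i) * z k else 0)"
    unfolding sum_divide_distrib
  proof (rule sum.cong)
    fix i assume "i \<in> {..<n}"
    then have "(x (Suc i) - r * x i) * (y (Suc i) - r * y i) / (1 - r\<^sup>2) =
        (x (Suc i) - r * x i) * (\<Sum>k\<le>n. if i < k then r ^ (k - Suc i) * z k else 0)"
      using r by (simp add: step)
    also have "\<dots> = (\<Sum>k\<le>n. if i < k then (x (Suc i) - r * x i) * r ^ (k - Suc i) * z k else 0)"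
      unfolding sum_distrib_left by (rule sum.cong) auto
    finally show "(x (Suc i) - r * x i) * (y (Suc i) - r * y i) / (1 - r\<^sup>2) =
        (\<Sum>k\<le>n. if i < k then (x (Suc i) - r * x i) * r ^ (k - Suc i) * z k else 0)" .
  qed simp
  also have "\<dots> = (\<Sum>k\<le>n. \<Sum>i<n. if i < k then (x (Suc i) - r * x i) * r ^ (k - Suc i) * z k else 0)"
    by (rule sum.swap)
  also have "\<dots> = (\<Sum>k\<le>n. (x k - r ^ k * x 0) * z k)"
  proof (rule sum.cong)
    fix k assume "k \<in> {..n}"
    then have "{..<n} \<inter> {i. i < k} = {..<k}" by auto
    then show "(\<Sum>i<n. if i < k then (x (Suc i) - r * x i) * r ^ (k - Suc i) * z k else 0) =
        (x k - r ^ k * x 0) * z k"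
      by (simp add: sum.If_cases flip: sum_ar_residual sum_distrib_right)
  qed simp
  finally show ?thesis
    by (simp add: ou_form_def y algebra_simps sum_subtractf sum_distrib_left)
qed

section \<open>The estimator on the grid expressed through the AR(1) form\<close>

lemma abs_grid_diff:
  assumes "L > 0" "n > 0"
  shows "\<bar>grid L n i - grid L n j\<bar> = real ((i - j) + (j - i)) * (L / real n)"
proof -
  have "\<bar>grid L n i - grid L n j\<bar> = \<bar>real i - real j\<bar> * (L / real n)"
    using assms by (simp add: grid_def abs_mult flip: left_diff_distrib del: times_divide_eq_right)
  also have "\<bar>real i - real j\<bar> = real ((i - j) + (j - i))"
    by (cases "i \<le> j") auto
  finally show ?thesis .
qed

lemma exp_cov_mat_eq_power:
  assumes "L > 0" "n > 0"
  shows "exp_cov_mat L n lam =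
    mat (n + 1) (n + 1) (\<lambda>(i, j). exp (- lam * (L / real n)) ^ ((i - j) + (j - i)))"
  unfolding exp_cov_mat_def abs_grid_diff[OF assms]
  by (rule eq_matI) (auto simp: mult_ac simp flip: exp_of_nat_mult)

lemma scalar_prod_inverse_exp_cov_mat:
  assumes L: "L > 0" "n > 0" "lam > 0"
  shows "scalar_prod (Matrix.vec (n + 1) x) (the (mat_inverse (exp_cov_mat L n lam)) *\<^sub>v Matrix.vec (n + 1) y) =
    ou_form (exp (- lam * (L / real n))) n x y"
proof -
  define r where "r = exp (- lam * (L / real n))"
  define N where "N = n + 1"
  define A where "A = mat N N (\<lambda>(i, j). r ^ ((i - j) + (j - i)))"
  have "0 < r" "r < 1" using L by (auto simp: r_def)
  then have r: "r\<^sup>2 \<noteq> 1" using power2_eq_1_iff[of r] by simp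
  have A: "A \<in> carrier_mat N N" by (simp add: A_def)
  have Az: "(A *\<^sub>v z) $ i = (\<Sum>k\<le>n. r ^ ((i - k) + (k - i)) * z $ k)"
    if "z \<in> carrier_vec N" "i \<le> n" for z i
    using that unfolding A_def N_def by (auto simp: scalar_prod_def atLeast0LessThan lessThan_Suc_atMost simp del: sum.op_ivl_Suc
        intro!: sum.cong)
  have form: "ou_form r n x (\<lambda>i. (A *\<^sub>v z) $ i) = (\<Sum>k\<le>n. x k * z $ k)"
    if "z \<in> carrier_vec N" for x z
    using ou_form_inverts_correlation[OF r] Az[OF that] by simp
  \<comment> \<open>Nonsingularity follows from the inversion formula itself: if A z = 0, then z^T z
    equals the form evaluated at z and A z, which is 0.\<close>
  have "Determinant.det A \<noteq> 0"
  proof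
    assume "Determinant.det A = 0"
    then obtain z where z: "z \<in> carrier_vec N" "z \<noteq> 0\<^sub>v N" "A *\<^sub>v z = 0\<^sub>v N"
      using det_0_iff_vec_prod_zero_field[OF A] by blast
    have "(\<Sum>k\<le>n. z $ k * z $ k) = ou_form r n (\<lambda>i. z $ i) (\<lambda>i. (A *\<^sub>v z) $ i)"
      using form[OF z(1)] by simp
    also have "\<dots> = 0"
      using z(3) by (simp add: ou_form_def N_def)
    finally have "\<forall>k\<le>n. z $ k = 0"
      by (subst (asm) sum_nonneg_eq_0_iff) auto
    then have "z = 0\<^sub>v N" using z(1) by (intro eq_vecI) (auto simp: N_def)
    with z(2) show False ..
  qed
  \<comment> \<open>The argument \<open>()\<close> fills the dummy slot of the matrix ring record.
    Being a unit rules out the result \<open>None\<close>, so \<open>the\<close> in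
    \<open>gls\<close> yields a genuine inverse.\<close>
  from det_non_zero_imp_unit[OF A this, of "()"]
  obtain P where P: "mat_inverse A = Some P" using mat_inverse(1)[OF A] by fastforce
  with mat_inverse(2)[OF A P] have AP: "A * P = 1\<^sub>m N" "P \<in> carrier_mat N N" by auto
  define z where "z = P *\<^sub>v Matrix.vec N y"
  have z: "z \<in> carrier_vec N" using AP by (simp add: z_def)
  have "A *\<^sub>v z = Matrix.vec N y"
    unfolding z_def using AP A by (simp flip: assoc_mult_mat_vec)
  with form[OF z, of x] have "ou_form r n x (\<lambda>i. Matrix.vec N y $ i) = (\<Sum>k\<le>n. x k * z $ k)" by simp
  then have "ou_form r n x y = (\<Sum>k\<le>n. x k * z $ k)"
    by (simp add: ou_form_def N_def)
  also have "\<dots> = scalar_prod (Matrix.vec N x) z"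
    using z by (auto simp: scalar_prod_def N_def atLeast0LessThan lessThan_Suc_atMost
        simp del: sum.op_ivl_Suc intro!: sum.cong)
  finally show ?thesis
    using P exp_cov_mat_eq_power[OF L(1,2)] by (simp add: z_def A_def r_def N_def)
qed

lemma gls_eq_ou_form:
  assumes "L > 0" "n > 0" "lam > 0"
  shows "gls (exp_cov_mat L n lam) (grid_vec L n X \<omega>) (grid_vec L n Y \<omega>) =
    ou_form (exp (- lam * (L / real n))) n (\<lambda>i. X (grid L n i) \<omega>) (\<lambda>i. Y (grid L n i) \<omega>) /
    ou_form (exp (- lam * (L / real n))) n (\<lambda>i. X (grid L n i) \<omega>) (\<lambda>i. X (grid L n i) \<omega>)"
  unfolding gls_def grid_vec_def Let_def scalar_prod_inverse_exp_cov_mat[OF assms] ..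

section \<open>Positivity of the form and the estimation error\<close>

lemma ou_form_nonneg:
  assumes "r\<^sup>2 \<le> 1"
  shows "0 \<le> ou_form r n x x"
  using assms by (auto simp: ou_form_def intro!: add_nonneg_nonneg divide_nonneg_nonneg sum_nonneg)

text \<open>Both parts of the quadratic form are nonnegative, so \<open>x 0\<close> and every
  prediction error of \<open>x\<close> vanish; each term of \<open>ou_form r n x y\<close> contains
  one of them as a factor.\<close>

lemma ou_form_null:
  assumes "r\<^sup>2 < 1" "ou_form r n x x = 0"
  shows "ou_form r n x y = 0"
proof -
  have "0 \<le> (\<Sum>i<n. (x (Suc i) - r * x i) * (x (Suc i) - r * x i))" by (simp add: sum_nonneg)
  moreover have "0 \<le> x 0 * x 0" by simp
  ultimately have *: "x 0 * x 0 = 0" "(\<Sum>i<n. (x (Suc i) - r * x i) * (x (Suc i) - r * x i)) = 0"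
    using assms unfolding ou_form_def by (smt (verit) divide_nonneg_pos divide_eq_0_iff)+
  then have "\<forall>i<n. x (Suc i) - r * x i = 0"
    by (subst (asm) sum_nonneg_eq_0_iff) auto
  then show ?thesis using * by (simp add: ou_form_def)
qed

text \<open>
  No case distinction on a vanishing denominator is needed: there the quotient is \<open>0\<close> by convention,
  but the left-hand side vanishes too.
\<close>
lemma ou_form_regression:
  assumes "r\<^sup>2 < 1"
  shows "ou_form r n x w =
    (ou_form r n x (\<lambda>i. x i * b + w i) / ou_form r n x x - b) * ou_form r n x x"
proof -
  have "(\<Sum>i<n. (x (Suc i) - r * x i) * (x (Suc i) * b + w (Suc i) - r * (x i * b + w i))) =
      b * (\<Sum>i<n. (x (Suc i) - r * x i) * (x (Suc i) - r * x i)) +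
      (\<Sum>i<n. (x (Suc i) - r * x i) * (w (Suc i) - r * w i))"
    unfolding sum_distrib_left sum.distrib[symmetric] by (rule sum.cong) (auto simp: algebra_simps)
  then have lin: "ou_form r n x (\<lambda>i. x i * b + w i) = b * ou_form r n x x + ou_form r n x w"
    by (simp add: ou_form_def algebra_simps add_divide_distrib)
  show ?thesis
    using lin ou_form_null[OF assms] by (cases "ou_form r n x x = 0") (auto simp: field_simps)
qed

section \<open>Gaussian moments and convergence in probability\<close>

text \<open>The fourth-moment identity is phrased through the second moment instead of a standard
  deviation, so that it also covers almost surely constant variables. It is the only distributional
  input to the product formula \<open>isserlis\<close>.\<close>

lemma integrable_centered_gaussian_power:
  assumes "gaussian_rv M V" "prob_space M" "(\<integral>\<omega>. V \<omega> \<partial>M) = 0"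
  shows "integrable M (\<lambda>\<omega>. V \<omega> ^ k)"
    and "(\<integral>\<omega>. V \<omega> ^ 4 \<partial>M) = 3 * (\<integral>\<omega>. V \<omega> ^ 2 \<partial>M)\<^sup>2"
proof -
  interpret prob_space M by fact
  have V[measurable]: "V \<in> borel_measurable M"
    using assms(1) by (simp add: gaussian_rv_def)
  have "integrable M (\<lambda>\<omega>. V \<omega> ^ k) \<and> (\<integral>\<omega>. V \<omega> ^ 4 \<partial>M) = 3 * (\<integral>\<omega>. V \<omega> ^ 2 \<partial>M)\<^sup>2"
  proof (cases "\<exists>\<mu> \<sigma>. \<sigma> > 0 \<and> distributed M lborel V (normal_density \<mu> \<sigma>)")
    case True
    then obtain \<mu> \<sigma> where s: "\<sigma> > 0" and D': "distributed M lborel V (normal_density \<mu> \<sigma>)" by blast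
    have "\<mu> = 0" using normal_distributed_expectation[OF s D'] assms(3) by simp
    with D' have D: "distributed M lborel V (normal_density 0 \<sigma>)" by simp
    have I: "integrable M (\<lambda>\<omega>. V \<omega> ^ k)" for k
      using integrable_normal_moment[OF s, of 0 k] distributed_integrable[OF D, of "\<lambda>x. x ^ k"] by simp
    have E: "(\<integral>\<omega>. V \<omega> ^ (2 * k) \<partial>M) = fact (2 * k) / ((2 / \<sigma>\<^sup>2)^k * fact k)" for k
      using integral_normal_moment_even[OF s, of 0 k] distributed_integral[OF D, of "\<lambda>x. x ^ (2 * k)"] by simp
    have "(\<integral>\<omega>. V \<omega> ^ 4 \<partial>M) = 3 * \<sigma> ^ 4" "(\<integral>\<omega>. V \<omega> ^ 2 \<partial>M) = \<sigma>\<^sup>2"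
      using E[of 2] E[of 1] s by (simp_all add: fact_numeral field_simps power2_eq_square power4_eq_xxxx)
    with I show ?thesis by simp
  next
    case False
    then obtain \<mu> where mu: "AE \<omega> in M. V \<omega> = \<mu>" using assms(1) by (auto simp: gaussian_rv_def)
    \<comment> \<open>All moments of an almost surely constant variable are powers of the constant;
      the mean forces that constant to be 0.\<close>
    have int_eq: "integrable M (\<lambda>\<omega>. V \<omega> ^ k) \<and> (\<integral>\<omega>. V \<omega> ^ k \<partial>M) = \<mu> ^ k" for k
    proof -
      have ae: "AE \<omega> in M. V \<omega> ^ k = \<mu> ^ k" using mu by eventually_elim simp
      have "integrable M (\<lambda>\<omega>. V \<omega> ^ k) \<longleftrightarrow> integrable M (\<lambda>\<omega>. \<mu> ^ k)"
        by (rule integrable_cong_AE) (use ae in auto)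
      moreover have "(\<integral>\<omega>. V \<omega> ^ k \<partial>M) = (\<integral>\<omega>. \<mu> ^ k \<partial>M)"
        by (rule integral_cong_AE) (use ae in auto)
      ultimately show ?thesis by (simp add: prob_space)
    qed
    from int_eq[of 1] assms(3) have "\<mu> = 0" by simp
    with int_eq[of k] int_eq[of 2] int_eq[of 4] show ?thesis by simp
  qed
  then show "integrable M (\<lambda>\<omega>. V \<omega> ^ k)"
    and "(\<integral>\<omega>. V \<omega> ^ 4 \<partial>M) = 3 * (\<integral>\<omega>. V \<omega> ^ 2 \<partial>M)\<^sup>2" by auto
qed

text \<open>Proved by polarisation: the product of four variables is a signed sum of fourth powers
  of linear combinations, and the hypothesis turns each fourth moment into a squared quadratic form
  in the second moments. Thus no joint density is involved, and degenerate vectors are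
  included.\<close>

lemma isserlis:
  fixes a b c d :: "'a \<Rightarrow> real"
  assumes int2: "\<And>p q r s. integrable M (\<lambda>\<omega>. (p * a \<omega> + q * b \<omega> + r * c \<omega> + s * d \<omega>)\<^sup>2)"
    and int4: "\<And>p q r s. integrable M (\<lambda>\<omega>. (p * a \<omega> + q * b \<omega> + r * c \<omega> + s * d \<omega>) ^ 4)"
    and E4: "\<And>p q r s. (\<integral>\<omega>. (p * a \<omega> + q * b \<omega> + r * c \<omega> + s * d \<omega>) ^ 4 \<partial>M) =
      3 * (\<integral>\<omega>. (p * a \<omega> + q * b \<omega> + r * c \<omega> + s * d \<omega>)\<^sup>2 \<partial>M)\<^sup>2"
  shows "integrable M (\<lambda>\<omega>. a \<omega> * b \<omega> * c \<omega> * d \<omega>)"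
    and "(\<integral>\<omega>. a \<omega> * b \<omega> * c \<omega> * d \<omega> \<partial>M) =
      (\<integral>\<omega>. a \<omega> * b \<omega> \<partial>M) * (\<integral>\<omega>. c \<omega> * d \<omega> \<partial>M) + (\<integral>\<omega>. a \<omega> * c \<omega> \<partial>M) * (\<integral>\<omega>. b \<omega> * d \<omega> \<partial>M) +
      (\<integral>\<omega>. a \<omega> * d \<omega> \<partial>M) * (\<integral>\<omega>. b \<omega> * c \<omega> \<partial>M)"
proof -
  define f where "f p q r s \<omega> = p * a \<omega> + q * b \<omega> + r * c \<omega> + s * d \<omega>" for p q r s \<omega>
  note I2 = int2[folded f_def] and I4 = int4[folded f_def] and F4 = E4[folded f_def]
  have polar: "integrable M (\<lambda>\<omega>. u \<omega> * v \<omega>)"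
    if "\<And>p q. integrable M (\<lambda>\<omega>. (p * u \<omega> + q * v \<omega>)\<^sup>2)" for u v :: "'a \<Rightarrow> real"
  proof -
    have "u \<omega> * v \<omega> = ((1 * u \<omega> + 1 * v \<omega>)\<^sup>2 - (1 * u \<omega> + (-1) * v \<omega>)\<^sup>2) / 4" for \<omega>
      by (simp add: power2_eq_square algebra_simps)
    then show ?thesis
      using that[of 1 1] that[of 1 "-1"] by (simp only:) auto
  qed
  have prods: "integrable M (\<lambda>\<omega>. a \<omega> * a \<omega>)" "integrable M (\<lambda>\<omega>. b \<omega> * b \<omega>)" "integrable M (\<lambda>\<omega>. c \<omega> * c \<omega>)"
    "integrable M (\<lambda>\<omega>. d \<omega> * d \<omega>)" "integrable M (\<lambda>\<omega>. a \<omega> * b \<omega>)" "integrable M (\<lambda>\<omega>. a \<omega> * c \<omega>)"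
    "integrable M (\<lambda>\<omega>. a \<omega> * d \<omega>)" "integrable M (\<lambda>\<omega>. b \<omega> * c \<omega>)" "integrable M (\<lambda>\<omega>. b \<omega> * d \<omega>)"
    "integrable M (\<lambda>\<omega>. c \<omega> * d \<omega>)"
    using int2[of 1 0 0 0] int2[of 0 1 0 0] int2[of 0 0 1 0] int2[of 0 0 0 1] polar[of a b] polar[of a c]
      polar[of a d] polar[of b c] polar[of b d] polar[of c d]
      int2[of _ _ 0 0] int2[of _ 0 _ 0] int2[of _ 0 0 _] int2[of 0 _ _ 0] int2[of 0 _ 0 _] int2[of 0 0 _ _]
    by (simp_all add: power2_eq_square)
  let ?E = "\<lambda>u v. \<integral>\<omega>. u \<omega> * v \<omega> \<partial>M"
  have F2: "(\<integral>\<omega>. (f p q r s \<omega>)\<^sup>2 \<partial>M) = p\<^sup>2 * ?E a a + q\<^sup>2 * ?E b b + r\<^sup>2 * ?E c c + s\<^sup>2 * ?E d d +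
      2 * p * q * ?E a b + 2 * p * r * ?E a c + 2 * p * s * ?E a d + 2 * q * r * ?E b c +
      2 * q * s * ?E b d + 2 * r * s * ?E c d" for p q r s
  proof -
    have "(f p q r s \<omega>)\<^sup>2 = p\<^sup>2 * (a \<omega> * a \<omega>) + q\<^sup>2 * (b \<omega> * b \<omega>) + r\<^sup>2 * (c \<omega> * c \<omega>) + s\<^sup>2 * (d \<omega> * d \<omega>) +
      2 * p * q * (a \<omega> * b \<omega>) + 2 * p * r * (a \<omega> * c \<omega>) + 2 * p * s * (a \<omega> * d \<omega>) + 2 * q * r * (b \<omega> * c \<omega>) +
      2 * q * s * (b \<omega> * d \<omega>) + 2 * r * s * (c \<omega> * d \<omega>)" for \<omega>
      by (simp add: f_def power2_eq_square algebra_simps)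
    then show ?thesis by (simp add: prods)
  qed
  \<comment> \<open>Each of the eight sign patterns with first sign + is weighted by the product of
    its signs. Only the mixed monomial survives, with coefficient 8 * 4! = 192.\<close>
  have P: "a \<omega> * b \<omega> * c \<omega> * d \<omega> =
      (f 1 1 1 1 \<omega> ^ 4 - f 1 1 1 (-1) \<omega> ^ 4 - f 1 1 (-1) 1 \<omega> ^ 4 + f 1 1 (-1) (-1) \<omega> ^ 4
       - f 1 (-1) 1 1 \<omega> ^ 4 + f 1 (-1) 1 (-1) \<omega> ^ 4 + f 1 (-1) (-1) 1 \<omega> ^ 4 - f 1 (-1) (-1) (-1) \<omega> ^ 4) / 192"
    for \<omega>
  proof -
    have even4: "(p + q) ^ 4 + (p - q) ^ 4 = 2 * p ^ 4 + 12 * p\<^sup>2 * q\<^sup>2 + 2 * q ^ 4" for p q :: real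
      by (simp add: power4_eq_xxxx power2_eq_square algebra_simps)
    have "192 * (x * y * z * w) =
      (x + y + z + w) ^ 4 - (x + y + z - w) ^ 4 - (x + y - z + w) ^ 4 + (x + y - z - w) ^ 4
       - (x - y + z + w) ^ 4 + (x - y + z - w) ^ 4 + (x - y - z + w) ^ 4 - (x - y - z - w) ^ 4"
      for x y z w :: real
    proof -
      have "12 * ((x + y)\<^sup>2 - (x - y)\<^sup>2) * ((z + w)\<^sup>2 - (z - w)\<^sup>2) = 192 * (x * y * z * w)"
        by (simp add: power2_eq_square algebra_simps)
      then show ?thesis
        using even4[of "x + y" "z + w"] even4[of "x + y" "z - w"] even4[of "x - y" "z + w"] even4[of "x - y" "z - w"]
        by (simp add: algebra_simps)
    qed
    from this[of "a \<omega>" "b \<omega>" "c \<omega>" "d \<omega>"] show ?thesis by (simp add: f_def)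
  qed
  show "integrable M (\<lambda>\<omega>. a \<omega> * b \<omega> * c \<omega> * d \<omega>)"
    unfolding P using I4 by auto
  \<comment> \<open>The same signed sum after taking expectations: \<open>T\<close> is the sum of
    the four second moments, and \<open>x\<close>, \<open>y\<close>, \<open>z\<close>,
    \<open>u\<close>, \<open>t\<close>, \<open>w\<close> are the mixed moments ab, ac, ad, bc, bd,
    cd.\<close>
  have Q: "(3 * (T + 2*x + 2*y + 2*z + 2*u + 2*t + 2*w)\<^sup>2 - 3 * (T + 2*x + 2*y - 2*z + 2*u - 2*t - 2*w)\<^sup>2
     - 3 * (T + 2*x - 2*y + 2*z - 2*u + 2*t - 2*w)\<^sup>2 + 3 * (T + 2*x - 2*y - 2*z - 2*u - 2*t + 2*w)\<^sup>2
     - 3 * (T - 2*x + 2*y + 2*z - 2*u - 2*t + 2*w)\<^sup>2 + 3 * (T - 2*x + 2*y - 2*z - 2*u + 2*t - 2*w)\<^sup>2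
     + 3 * (T - 2*x - 2*y + 2*z + 2*u - 2*t - 2*w)\<^sup>2 - 3 * (T - 2*x - 2*y - 2*z + 2*u + 2*t + 2*w)\<^sup>2)
     = 192 * (x * w + y * t + z * u)" for T x y z u t w :: real
    by (simp add: power2_eq_square algebra_simps)
  show "(\<integral>\<omega>. a \<omega> * b \<omega> * c \<omega> * d \<omega> \<partial>M) = ?E a b * ?E c d + ?E a c * ?E b d + ?E a d * ?E b c"
    unfolding P using Q[of "?E a a + ?E b b + ?E c c + ?E d d" "?E a b" "?E a c" "?E a d" "?E b c" "?E b d" "?E c d"]
    by (simp add: I4 F4 F2)
qed

text \<open>By Markov's inequality a bounded mean makes the nonnegative factors \<open>D n\<close>
  tight, and a tight factor preserves convergence to 0 in probability. The large values of
  \<open>D n\<close> and the deviations of \<open>G n\<close> are handled by a union bound.\<close>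

lemma tendsto_in_prob_mult_bounded_mean:
  assumes "prob_space M"
    and G: "\<And>n. G n \<in> borel_measurable M" and D: "\<And>n. integrable M (D n)" "\<And>n \<omega>. 0 \<le> D n \<omega>"
    and bd: "\<forall>\<^sub>F n in sequentially. (\<integral>\<omega>. D n \<omega> \<partial>M) \<le> C"
    and lim: "tendsto_in_prob M G b"
  shows "tendsto_in_prob M (\<lambda>n \<omega>. (G n \<omega> - b) * D n \<omega>) 0"
  unfolding tendsto_in_prob_def
proof (intro allI impI)
  interpret prob_space M by fact
  fix e :: real assume e: "e > 0"
  note [measurable] = G borel_measurable_integrable[OF D(1)]
  let ?m = "\<lambda>n. prob {\<omega> \<in> space M. \<bar>(G n \<omega> - b) * D n \<omega> - 0\<bar> > e}"
  define C' where "C' = max C 1"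
  have C': "C' > 0" "C \<le> C'" by (auto simp: C'_def)
  show "?m \<longlonglongrightarrow> 0"
  proof (rule LIMSEQ_I)
    fix \<eta> :: real assume \<eta>: "\<eta> > 0"
    \<comment> \<open>Chosen so that the Markov bound C' / T is \<eta> / 2; the deviations of
      \<open>G n\<close> get the other half.\<close>
    define T where "T = 2 * C' / \<eta>"
    have T: "T > 0" using \<eta> C' by (simp add: T_def)
    let ?g = "\<lambda>n. prob {\<omega> \<in> space M. \<bar>G n \<omega> - b\<bar> > e / T}"
    have "?g \<longlonglongrightarrow> 0" using lim e T by (simp add: tendsto_in_prob_def)
    then have "\<forall>\<^sub>F n in sequentially. ?g n < \<eta> / 2"
      using \<eta> by (intro order_tendstoD) auto
    with bd have "\<forall>\<^sub>F n in sequentially. ?m n < \<eta>"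
    proof eventually_elim
      case (elim n)
      have "?m n \<le> prob ({\<omega> \<in> space M. \<bar>G n \<omega> - b\<bar> > e / T} \<union> {\<omega> \<in> space M. D n \<omega> \<ge> T})"
      proof (rule finite_measure_mono)
        show "{\<omega> \<in> space M. \<bar>(G n \<omega> - b) * D n \<omega> - 0\<bar> > e} \<subseteq>
            {\<omega> \<in> space M. \<bar>G n \<omega> - b\<bar> > e / T} \<union> {\<omega> \<in> space M. D n \<omega> \<ge> T}"
        proof safe
          fix \<omega> assume *: "e < \<bar>(G n \<omega> - b) * D n \<omega> - 0\<bar>" "\<not> T \<le> D n \<omega>"
          show "\<bar>G n \<omega> - b\<bar> > e / T"
          proof (rule ccontr)
            assume "\<not> \<bar>G n \<omega> - b\<bar> > e / T"
            then have "\<bar>G n \<omega> - b\<bar> * D n \<omega> \<le> e / T * T"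
              using * D(2)[of n \<omega>] T e by (intro mult_mono) auto
            with * D(2)[of n \<omega>] T show False by (simp add: abs_mult)
          qed
        qed
      qed measurable
      also have "\<dots> \<le> ?g n + prob {\<omega> \<in> space M. D n \<omega> \<ge> T}"
        by (rule measure_Un_le) measurable
      also have "prob {\<omega> \<in> space M. D n \<omega> \<ge> T} \<le> (\<integral>\<omega>. D n \<omega> \<partial>M) / T"
        by (rule integral_Markov_inequality_measure[where A = "{}"]) (use D T in auto)
      also have "\<dots> \<le> C' / T" using elim C' T by (intro divide_right_mono) auto
      also have "C' / T = \<eta> / 2" using C' \<eta> by (simp add: T_def)
      finally show ?case using elim by simp
    qed
    then show "\<exists>no. \<forall>n\<ge>no. norm (?m n - 0) < \<eta>"
      by (auto simp: eventually_sequentially)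
  qed
qed

text \<open>\<open>Q\<close> is independent of \<open>n\<close>, so the probability that |Q| exceeds
  a positive level is a constant, bounded by a sequence tending to 0.\<close>

lemma AE_zero_if_dominated:
  assumes "prob_space M"
    and Q: "Q \<in> borel_measurable M" and U: "\<And>i n. i \<in> I \<Longrightarrow> U i n \<in> borel_measurable M"
    and I: "finite I" and lim: "\<And>i. i \<in> I \<Longrightarrow> tendsto_in_prob M (U i) 0"
    and dom: "\<forall>\<^sub>F n in sequentially. \<forall>\<omega>. \<bar>Q \<omega>\<bar> \<le> C * (\<Sum>i\<in>I. \<bar>U i n \<omega>\<bar>)"
  shows "AE \<omega> in M. Q \<omega> = 0"
proof -
  interpret prob_space M by fact
  note [measurable] = Q U
  have ae: "AE \<omega> in M. \<bar>Q \<omega>\<bar> \<le> e" if e: "e > 0" for e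
  proof -
    \<comment> \<open>If all |U i n| are at most \<delta>, the dominating sum is at most
      \<open>e\<close>. The two summands 1 keep the denominator positive when \<open>C\<close> is 0
      or \<open>I\<close> is empty.\<close>
    define \<delta> where "\<delta> = e / ((\<bar>C\<bar> + 1) * (card I + 1))"
    have \<delta>: "\<delta> > 0" using e by (auto simp: \<delta>_def intro!: divide_pos_pos mult_pos_pos)
    let ?u = "\<lambda>i n. {\<omega> \<in> space M. \<bar>U i n \<omega> - 0\<bar> > \<delta>}"
    have "(\<lambda>n. \<Sum>i\<in>I. prob (?u i n)) \<longlonglongrightarrow> (\<Sum>i\<in>I. 0)"
      using lim \<delta> by (intro tendsto_sum) (auto simp: tendsto_in_prob_def)
    moreover have "\<forall>\<^sub>F n in sequentially. prob {\<omega> \<in> space M. \<bar>Q \<omega>\<bar> > e} \<le> (\<Sum>i\<in>I. prob (?u i n))"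
      using dom
    proof eventually_elim
      case (elim n)
      have "prob {\<omega> \<in> space M. \<bar>Q \<omega>\<bar> > e} \<le> prob (\<Union>i\<in>I. ?u i n)"
      proof (rule finite_measure_mono)
        show "{\<omega> \<in> space M. \<bar>Q \<omega>\<bar> > e} \<subseteq> (\<Union>i\<in>I. ?u i n)"
        proof
          fix \<omega> assume w: "\<omega> \<in> {\<omega> \<in> space M. \<bar>Q \<omega>\<bar> > e}"
          show "\<omega> \<in> (\<Union>i\<in>I. ?u i n)"
          proof (rule ccontr)
            assume "\<omega> \<notin> (\<Union>i\<in>I. ?u i n)"
            with w have "(\<Sum>i\<in>I. \<bar>U i n \<omega>\<bar>) \<le> (\<Sum>i\<in>I. \<delta>)" by (intro sum_mono) force
            also have "\<dots> \<le> (card I + 1) * \<delta>" using \<delta> by simp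
            finally have "C * (\<Sum>i\<in>I. \<bar>U i n \<omega>\<bar>) \<le> (\<bar>C\<bar> + 1) * ((card I + 1) * \<delta>)"
              by (intro mult_mono) (auto intro: sum_nonneg)
            also have "\<dots> = (\<bar>C\<bar> + 1) * (real (card I) + 1) * \<delta>" by (simp only: mult.assoc of_nat_add of_nat_1)
            also have "\<dots> = e"
            proof -
              have "(\<bar>C\<bar> + 1) * (real (card I) + 1) > 0" by (intro mult_pos_pos) auto
              then have "(\<bar>C\<bar> + 1) * (real (card I) + 1) \<noteq> 0" by linarith
              then show ?thesis unfolding \<delta>_def of_nat_add of_nat_1 times_divide_eq_right by (rule nonzero_mult_div_cancel_left)
            qed
            finally show False using elim[rule_format, of \<omega>] w by simp
          qed
        qed
      qed (use I in \<open>auto intro!: sets.finite_UN\<close>)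
      also have "\<dots> \<le> (\<Sum>i\<in>I. prob (?u i n))"
        by (rule finite_measure_subadditive_finite) (use I in auto)
      finally show ?case .
    qed
    ultimately have "prob {\<omega> \<in> space M. \<bar>Q \<omega>\<bar> > e} \<le> 0"
      using tendsto_lowerbound[OF _ _ trivial_limit_sequentially] by fastforce
    then have "prob {\<omega> \<in> space M. \<bar>Q \<omega>\<bar> > e} = 0" by (simp add: measure_le_0_iff)
    then have "AE \<omega> in M. \<omega> \<notin> {\<omega> \<in> space M. \<bar>Q \<omega>\<bar> > e}"
      by (subst (asm) prob_eq_0) auto
    then show ?thesis using AE_space by eventually_elim auto
  qed
  have "AE \<omega> in M. \<forall>m::nat. \<bar>Q \<omega>\<bar> \<le> 1 / Suc m"
    using ae by (simp add: AE_all_countable)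
  then show ?thesis
  proof eventually_elim
    case (elim \<omega>)
    show ?case
    proof (rule ccontr)
      assume "Q \<omega> \<noteq> 0"
      then obtain m where "1 / Suc m < \<bar>Q \<omega>\<bar>"
        using reals_Archimedean[of "\<bar>Q \<omega>\<bar>"] by (auto simp: inverse_eq_divide)
      with elim show False by (meson not_less)
    qed
  qed
qed

section \<open>Consequences of condition A\<close>

text \<open>Replacing x by -x in the quotient multiplies it by (-1)^m, where m is the order of
  vanishing, while the limit is the same nonzero number. Hence m is even.\<close>

lemma even_fps_expansion_leading_term:
  fixes f :: "real \<Rightarrow> real"
  assumes exp: "f has_fps_expansion F" and "F \<noteq> 0" and ev: "\<forall>\<^sub>F x in nhds 0. f (- x) = f x"
  shows "((\<lambda>x. f x / x ^ subdegree F) \<longlongrightarrow> fps_nth F (subdegree F)) (at 0)"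
    and "even (subdegree F)"
proof -
  define m c where "m = subdegree F" and "c = fps_nth F m"
  have c: "c \<noteq> 0" using assms(2) by (simp add: c_def m_def)
  have "(\<lambda>x. if x = 0 then c else f x / x ^ m) has_fps_expansion fps_shift m F"
    by (rule has_fps_expansion_shift[OF exp]) (simp_all add: m_def c_def)
  then have "isCont (\<lambda>x. if x = 0 then c else f x / x ^ m) 0"
    using has_fps_expansion_imp_continuous[of _ _ UNIV] by blast
  then have "((\<lambda>x. if x = 0 then c else f x / x ^ m) \<longlongrightarrow> c) (at 0)"
    by (simp add: isCont_def)
  then have lim: "((\<lambda>x. f x / x ^ m) \<longlongrightarrow> c) (at 0)"
    by (rule Lim_transform_eventually) (auto simp: eventually_at_filter)
  then show "((\<lambda>x. f x / x ^ subdegree F) \<longlongrightarrow> fps_nth F (subdegree F)) (at 0)"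
    by (simp add: m_def c_def)
  have "filterlim uminus (at 0) (at (0::real))"
    unfolding filterlim_at by (auto intro!: tendsto_eq_intros simp: eventually_at_filter)
  from filterlim_compose[OF lim this] have "((\<lambda>x. f (- x) / (- x) ^ m) \<longlongrightarrow> c) (at 0)" .
  moreover have "\<forall>\<^sub>F x in at 0. f (- x) / (- x) ^ m = (- 1) ^ m * (f x / x ^ m)"
    using ev unfolding eventually_at_filter
    by eventually_elim (cases "even m"; simp)
  ultimately have "((\<lambda>x. (- 1) ^ m * (f x / x ^ m)) \<longlongrightarrow> c) (at 0)"
    by (rule Lim_transform_eventually)
  moreover have "((\<lambda>x. (- 1) ^ m * (f x / x ^ m)) \<longlongrightarrow> (- 1) ^ m * c) (at 0)"
    by (intro tendsto_intros lim)
  ultimately have "(- 1) ^ m * c = c"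
    using tendsto_unique by (metis trivial_limit_at)
  then show "even (subdegree F)" using c m_def by (cases "even m") auto
qed

lemma cond_A_even:
  assumes "cond_A L c \<alpha> K" "t \<in> {-L..L}"
  shows "K (- t) = K t"
proof -
  have "- t \<in> {-L..L}" using assms(2) by auto
  with assms show ?thesis unfolding cond_A_def by metis
qed

text \<open>The normalisation \<open>B 0 = 0\<close> is forced: B behaves like c t^\<alpha> with
  \<alpha> > 0, so it tends to 0 from the right, and \<open>B\<close> is continuous at 0.\<close>

lemma cond_A_decomposition:
  assumes "cond_A L c \<alpha> K" "L > 0"
  obtains A B F where
    "\<forall>t\<in>{-L..L}. K t = A t + B t"
    "A has_fps_expansion F" "\<forall>\<^sub>F x in nhds 0. A (- x) = A x"
    "B 0 = 0" "(\<lambda>t. B t - c * t powr \<alpha>) \<in> o[at_right 0](\<lambda>t. t powr \<alpha>)"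
proof -
  from assms obtain A B Db where al: "\<alpha> > 0"
    and K: "\<forall>t\<in>{-L..L}. K t = A t + B t"
    and A: "\<forall>t\<in>{-L..L}. A (-t) = A t" "real_analytic_on A {-L..L}"
    and B: "\<forall>t\<in>{-L..L}. B (-t) = B t" "continuous_on {-L..L} B"
    and Db: "\<forall>t\<in>{0<..L}. Db 0 t = B t"
      "\<forall>k. (\<lambda>t. Db k t - falling \<alpha> k * c * t powr (\<alpha> - real k)) \<in> o[at_right 0](\<lambda>t. t powr (\<alpha> - real k))"
    unfolding cond_A_def by blast
  have "0 \<in> {-L..L}" using assms(2) by simp
  with A(2) have "\<exists>F. (\<lambda>h. A (0 + h)) has_fps_expansion F"
    unfolding real_analytic_on_def by (rule bspec)
  then obtain F where F: "A has_fps_expansion F" by auto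
  have "\<forall>\<^sub>F x in nhds (0::real). x \<in> {-L<..<L}"
    using assms(2) by (intro eventually_nhds_in_open) auto
  then have ev: "\<forall>\<^sub>F x in nhds 0. A (- x) = A x"
    by eventually_elim (use A(1) in auto)
  have near: "\<forall>\<^sub>F t in at_right 0. t \<in> {0<..L}"
    using assms(2) eventually_at_right_real[of 0 L] by (auto elim!: eventually_mono)
  have "Gamma (\<alpha> + 1) \<noteq> 0" using Gamma_real_pos[of "\<alpha> + 1"] al by linarith
  then have fall: "falling \<alpha> 0 = 1" by (simp add: falling_def)
  have asym: "(\<lambda>t. B t - c * t powr \<alpha>) \<in> o[at_right 0](\<lambda>t. t powr \<alpha>)"
      proof (rule landau_o.small.in_cong[THEN iffD1])
    show "\<forall>\<^sub>F t in at_right 0. Db 0 t - c * t powr \<alpha> = B t - c * t powr \<alpha>"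
      using near by eventually_elim (simp add: Db(1))
    show "(\<lambda>t. Db 0 t - c * t powr \<alpha>) \<in> o[at_right 0](\<lambda>t. t powr \<alpha>)"
      using Db(2)[rule_format, of 0] fall by simp
  qed
  have pow: "((\<lambda>t. t powr \<alpha>) \<longlongrightarrow> 0) (at_right (0::real))"
    using al by real_asymp
  have "((\<lambda>t. (B t - c * t powr \<alpha>) / t powr \<alpha>) \<longlongrightarrow> 0) (at_right 0)"
    using asym by (rule smalloD_tendsto)
  then have "((\<lambda>t. (B t - c * t powr \<alpha>) / t powr \<alpha> * t powr \<alpha> + c * t powr \<alpha>) \<longlongrightarrow> 0 * 0 + c * 0) (at_right 0)"
    by (intro tendsto_intros pow)
  then have "((\<lambda>t. (B t - c * t powr \<alpha>) / t powr \<alpha> * t powr \<alpha> + c * t powr \<alpha>) \<longlongrightarrow> 0) (at_right 0)"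
    by simp
  then have B0: "(B \<longlongrightarrow> 0) (at_right 0)"
    by (rule Lim_transform_eventually) (use near in eventually_elim, simp)
  have "(B \<longlongrightarrow> B 0) (at 0 within {-L..L})"
    using B(2) assms(2) by (auto simp: continuous_on_def)
  then have "(B \<longlongrightarrow> B 0) (at 0 within {0..L})"
    by (rule tendsto_within_subset) auto
  then have "(B \<longlongrightarrow> B 0) (at_right 0)"
    using at_within_Icc_at_right[OF assms(2)] by simp
  with B0 have "B 0 = 0" by (rule tendsto_unique[OF trivial_limit_at_right_real, rotated])
  then show thesis using that[OF K F ev _ asym] by simp
qed

text \<open>If \<open>K\<close> vanished identically, A = -B would behave like -c t^\<alpha> at 0+.
  An even analytic germ either vanishes or behaves like a multiple of an even power of t, and
  \<alpha> is not an even integer.\<close>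

lemma cond_A_imp_nonzero:
  assumes "cond_A L c \<alpha> K" "L > 0" "c \<noteq> 0"
  shows "\<exists>t. K t \<noteq> 0"
proof (rule ccontr)
  assume "\<nexists>t. K t \<noteq> 0"
  then have K: "K t = 0" for t by blast
  obtain A B F where AB: "\<forall>t\<in>{-L..L}. K t = A t + B t"
    and F: "A has_fps_expansion F" and ev: "\<forall>\<^sub>F x in nhds 0. A (- x) = A x"
    and B0: "B 0 = 0"
    and B: "(\<lambda>t. B t - c * t powr \<alpha>) \<in> o[at_right 0](\<lambda>t. t powr \<alpha>)"
    by (rule cond_A_decomposition[OF assms(1,2)])
  have al: "\<alpha> > 0" "\<And>m::nat. \<alpha> \<noteq> 2 * real m" using assms(1) by (auto simp: cond_A_def)
  have near: "\<forall>\<^sub>F t in at_right 0. t \<in> {0<..<L}"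
    using assms(2) by (intro eventually_at_right_real)
  have "((\<lambda>t. (B t - c * t powr \<alpha>) / t powr \<alpha>) \<longlongrightarrow> 0) (at_right 0)"
    using B by (rule smalloD_tendsto)
  then have "((\<lambda>t. - ((B t - c * t powr \<alpha>) / t powr \<alpha>) - c) \<longlongrightarrow> - 0 - c) (at_right 0)"
    by (intro tendsto_intros)
  then have lim: "((\<lambda>t. A t / t powr \<alpha>) \<longlongrightarrow> - c) (at_right 0)"
    unfolding minus_zero diff_0
  proof (rule Lim_transform_eventually)
    show "\<forall>\<^sub>F t in at_right 0. - ((B t - c * t powr \<alpha>) / t powr \<alpha>) - c = A t / t powr \<alpha>"
      using near
    proof eventually_elim
      case (elim t)
      then have "B t = - A t" using AB[rule_format, of t] K[of t] by auto
      with elim show ?case by (simp add: field_simps)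
    qed
  qed
  show False
  proof (cases "F = 0")
    case True
    then have "\<forall>\<^sub>F t in nhds 0. A t = 0" using F by (auto simp: has_fps_expansion_def elim: eventually_mono)
    then have "\<forall>\<^sub>F t in at_right 0. A t / t powr \<alpha> = 0"
      unfolding eventually_at_filter by eventually_elim simp
    then have "((\<lambda>t. A t / t powr \<alpha>) \<longlongrightarrow> 0) (at_right 0)"
      by (rule tendsto_eventually)
    with lim have "- c = 0" by (rule tendsto_unique[OF trivial_limit_at_right_real])
    with assms(3) show False by simp
  next
    case False
    define m where "m = subdegree F"
    have nz: "fps_nth F m \<noteq> 0" using False by (simp add: m_def)
    have "((\<lambda>t. A t / t ^ m) \<longlongrightarrow> fps_nth F m) (at_right 0)"
      using even_fps_expansion_leading_term(1)[OF F False ev] unfolding m_def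
      by (rule tendsto_within_subset) auto
    \<comment> \<open>Dividing the two asymptotics of \<open>A\<close> gives t^(m - \<alpha>) a
      finite nonzero limit, which is impossible for m < \<alpha> and for m > \<alpha>.\<close>
    from tendsto_divide[OF lim this nz]
    have "((\<lambda>t. t powr (m - \<alpha>)) \<longlongrightarrow> - c / fps_nth F m) (at_right 0)"
    proof (rule Lim_transform_eventually)
      have "\<forall>\<^sub>F t in at_right 0. A t / t powr \<alpha> \<noteq> 0"
        by (rule tendsto_imp_eventually_ne[OF lim]) (use assms(3) in simp)
      with near show "\<forall>\<^sub>F t in at_right 0. A t / t powr \<alpha> / (A t / t ^ m) = t powr (m - \<alpha>)"
        by eventually_elim (auto simp: powr_diff powr_realpow)
    qed
    moreover obtain k where "m = 2 * k"
      using even_fps_expansion_leading_term(2)[OF F False ev] by (auto simp: m_def)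
    with al(2)[of k] have "real m \<noteq> \<alpha>" by simp
    then consider "m < \<alpha>" | "m > \<alpha>" by linarith
    then show False
    proof cases
      case 1
      then have "filterlim (\<lambda>t. t powr (m - \<alpha>)) at_infinity (at_right 0)" by real_asymp
      with calculation show False
        by (meson not_tendsto_and_filterlim_at_infinity trivial_limit_at_right_real)
    next
      case 2
      then have "((\<lambda>t. t powr (m - \<alpha>)) \<longlongrightarrow> 0) (at_right 0)" by real_asymp
      with calculation have "- c / fps_nth F m = 0"
        by (rule tendsto_unique[OF trivial_limit_at_right_real])
      with assms(3) nz show False by simp
    qed
  qed
qed

text \<open>Subtracting \<open>A 0\<close> leaves an even germ vanishing at 0, hence zero or of
  order at least 2; the part \<open>B\<close> is O(t^\<alpha>) with \<alpha> > 2. This is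
  mean-square smoothness of the field: increments over a step h have variance O(h^2).\<close>

lemma cond_A_quadratic:
  assumes "cond_A L c \<alpha> K" "L > 0" "\<alpha> > 2"
  shows "\<exists>C. \<forall>\<^sub>F t in at_right 0. \<bar>K 0 - K t\<bar> \<le> C * t\<^sup>2"
proof -
  obtain A B F where AB: "\<forall>t\<in>{-L..L}. K t = A t + B t"
    and F: "A has_fps_expansion F" and ev: "\<forall>\<^sub>F x in nhds 0. A (- x) = A x"
    and B: "B 0 = 0" "(\<lambda>t. B t - c * t powr \<alpha>) \<in> o[at_right 0](\<lambda>t. t powr \<alpha>)"
    by (rule cond_A_decomposition[OF assms(1,2)])
  have near: "\<forall>\<^sub>F t in at_right 0. t \<in> {0<..<L}"
    using assms(2) by (intro eventually_at_right_real)
  have pow: "(\<lambda>t. t powr \<alpha>) \<in> O[at_right 0](\<lambda>t. t\<^sup>2)"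
    using assms(3) by real_asymp
  have "(\<lambda>t. (B t - c * t powr \<alpha>) + c * t powr \<alpha>) \<in> O[at_right 0](\<lambda>t. t\<^sup>2)"
    using landau_o.small_imp_big[OF B(2)] pow
    by (intro sum_in_bigo(1)) (auto intro: landau_o.big_trans)
  then have BO: "B \<in> O[at_right 0](\<lambda>t. t\<^sup>2)" by simp
  have AO: "(\<lambda>t. A t - A 0) \<in> O[at_right 0](\<lambda>t. t\<^sup>2)"
  proof -
    define G where "G = F - fps_const (A 0)"
    have G: "(\<lambda>t. A t - A 0) has_fps_expansion G"
      unfolding G_def by (intro fps_expansion_intros F)
    have ev': "\<forall>\<^sub>F x in nhds 0. A (- x) - A 0 = A x - A 0"
      using ev by eventually_elim simp
    show ?thesis
    proof (cases "G = 0")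
      case True
      then have "\<forall>\<^sub>F t in nhds 0. A t - A 0 = 0"
        using G by (auto simp: has_fps_expansion_def elim: eventually_mono)
      then have "\<forall>\<^sub>F t in at_right 0. A t - A 0 = 0"
        unfolding eventually_at_filter by eventually_elim simp
      then show ?thesis by (rule landau_o.big.in_cong[THEN iffD2]) simp
    next
      case False
      define m where "m = subdegree G"
      have "fps_nth G 0 = 0"
        using G by (auto simp: has_fps_expansion_def eval_fps_at_0 dest: eventually_nhds_x_imp_x)
      then have "m \<noteq> 0" using False unfolding m_def by (metis nth_subdegree_nonzero)
      moreover have "even m"
        using even_fps_expansion_leading_term(2)[OF G False] ev' by (simp add: m_def)
      ultimately have "m \<ge> 2" by (auto elim!: evenE)
      have "((\<lambda>t. (A t - A 0) / t ^ m) \<longlongrightarrow> fps_nth G m) (at_right 0)"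
        using even_fps_expansion_leading_term(1)[OF G False] ev' unfolding m_def
        by (intro tendsto_within_subset[of _ _ 0 UNIV "{0<..}"]) auto
      then have "(\<lambda>t. A t - A 0) \<in> O[at_right 0](\<lambda>t. t ^ m)"
        by (rule bigoI_tendsto) (use near in eventually_elim, simp)
      also have "(\<lambda>t. t ^ m) \<in> O[at_right 0](\<lambda>t::real. t\<^sup>2)"
      proof (rule bigoI[where c = 1])
        show "\<forall>\<^sub>F t in at_right 0. norm (t ^ m) \<le> 1 * norm (t\<^sup>2 :: real)"
          using eventually_at_right_real[of 0 "1::real"]
        proof (rule eventually_mono)
          show "norm (t ^ m) \<le> 1 * norm (t\<^sup>2)" if "t \<in> {0<..<1}" for t :: real
            using that power_decreasing[OF \<open>m \<ge> 2\<close>, of t] by simp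
        qed simp
      qed
      finally show ?thesis .
    qed
  qed
  from sum_in_bigo(1)[OF AO BO] obtain C
    where "\<forall>\<^sub>F t in at_right 0. norm (A t - A 0 + B t) \<le> C * norm (t\<^sup>2)"
    by (auto simp: bigo_def)
  with near have "\<forall>\<^sub>F t in at_right 0. \<bar>K 0 - K t\<bar> \<le> C * t\<^sup>2"
    by eventually_elim (use AB B(1) assms(2) in auto)
  then show ?thesis ..
qed

section \<open>Stationary Gaussian fields\<close>

lemma stationary_gaussian_fieldD:
  assumes "stationary_gaussian_field M Z K"
  shows "finite J \<Longrightarrow> gaussian_rv M (\<lambda>\<omega>. \<Sum>k\<in>UNIV. \<Sum>s\<in>J. a k s * Z k s \<omega>)"
    and "(\<integral>\<omega>. Z k s \<omega> \<partial>M) = 0"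
    and "(\<integral>\<omega>. Z k s \<omega> * Z l t \<omega> \<partial>M) = K k l (t - s)"
proof -
  have mean: "(\<integral>\<omega>. Z k s \<omega> \<partial>M) = 0" for k s
    using assms by (simp add: stationary_gaussian_field_def)
  show "(\<integral>\<omega>. Z k s \<omega> \<partial>M) = 0" by (fact mean)
  have "covar M (Z k s) (Z l (s + (t - s))) = K k l (t - s)"
    using assms unfolding stationary_gaussian_field_def by blast
  then show "(\<integral>\<omega>. Z k s \<omega> * Z l t \<omega> \<partial>M) = K k l (t - s)"
    by (simp add: covar_def mean)
  show "gaussian_rv M (\<lambda>\<omega>. \<Sum>k\<in>UNIV. \<Sum>s\<in>J. a k s * Z k s \<omega>)" if "finite J"
    using assms that by (simp add: stationary_gaussian_field_def)
qed

lemma field_combination_gaussian: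
  fixes Z :: "'k::finite \<Rightarrow> real \<Rightarrow> 'a \<Rightarrow> real"
  assumes "stationary_gaussian_field M Z K"
  shows "gaussian_rv M (\<lambda>\<omega>. p * Z k1 s1 \<omega> + q * Z k2 s2 \<omega> + r * Z k3 s3 \<omega> + s * Z k4 s4 \<omega>)"
proof -
  define J where "J = {s1, s2, s3, s4}"
  \<comment> \<open>A Kronecker delta at one component and one site, scaled by \<open>y\<close>.
    Adding four of them lets coinciding sites accumulate their coefficients.\<close>
  define e where "e k' t' y k t = (if k = k' then if t = t' then y else 0 else 0)"
    for k' k :: 'k and t' t y :: real
  have e: "(\<Sum>k\<in>UNIV. \<Sum>t\<in>J. e k' t' y k t * Z k t \<omega>) = y * Z k' t' \<omega>" if "t' \<in> J" for k' t' y \<omega>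
  proof -
    have "(\<Sum>t\<in>J. e k' t' y k t * Z k t \<omega>) = (if k = k' then y * Z k t' \<omega> else 0)" for k
      using that by (cases "k = k'") (simp_all add: e_def J_def if_distrib[where f = "\<lambda>u. u * _"] sum.delta cong: if_cong)
    then show ?thesis by simp
  qed
  have "gaussian_rv M (\<lambda>\<omega>. \<Sum>k\<in>UNIV. \<Sum>t\<in>J. (e k1 s1 p k t + e k2 s2 q k t + e k3 s3 r k t + e k4 s4 s k t) * Z k t \<omega>)"
    by (rule stationary_gaussian_fieldD(1)[OF assms]) (simp add: J_def)
  then show ?thesis
    by (simp only: distrib_right sum.distrib) (simp add: e J_def[THEN eqset_imp_iff])
qed

lemma field_gaussian:
  assumes "stationary_gaussian_field M Z K"
  shows "gaussian_rv M (Z k s)"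
  using field_combination_gaussian[OF assms, of 1 k s 0 k s 0 k s 0 k s] by simp

lemma field_combination_centered:
  assumes F: "stationary_gaussian_field M Z K" and P: "prob_space M"
  shows "(\<integral>\<omega>. p * Z k1 s1 \<omega> + q * Z k2 s2 \<omega> + r * Z k3 s3 \<omega> + s * Z k4 s4 \<omega> \<partial>M) = 0"
proof -
  have "integrable M (Z k s)" for k s
    using integrable_centered_gaussian_power(1)[OF field_gaussian[OF F] P stationary_gaussian_fieldD(2)[OF F], of k s 1]
    by simp
  then show ?thesis by (simp add: stationary_gaussian_fieldD(2)[OF F])
qed

lemma field_isserlis:
  assumes F: "stationary_gaussian_field M Z K" and P: "prob_space M"
  shows "integrable M (\<lambda>\<omega>. Z k1 s1 \<omega> * Z k2 s2 \<omega> * Z k3 s3 \<omega> * Z k4 s4 \<omega>)"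
    and "(\<integral>\<omega>. Z k1 s1 \<omega> * Z k2 s2 \<omega> * Z k3 s3 \<omega> * Z k4 s4 \<omega> \<partial>M) =
      K k1 k2 (s2 - s1) * K k3 k4 (s4 - s3) + K k1 k3 (s3 - s1) * K k2 k4 (s4 - s2) +
      K k1 k4 (s4 - s1) * K k2 k3 (s3 - s2)"
proof -
  note G = integrable_centered_gaussian_power
    [OF field_combination_gaussian[OF F] P field_combination_centered[OF F P]]
  note I = isserlis[of M "Z k1 s1" "Z k2 s2" "Z k3 s3" "Z k4 s4", OF G(1) G(1) G(2)]
  show "integrable M (\<lambda>\<omega>. Z k1 s1 \<omega> * Z k2 s2 \<omega> * Z k3 s3 \<omega> * Z k4 s4 \<omega>)" by (rule I(1))
  show "(\<integral>\<omega>. Z k1 s1 \<omega> * Z k2 s2 \<omega> * Z k3 s3 \<omega> * Z k4 s4 \<omega> \<partial>M) =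
      K k1 k2 (s2 - s1) * K k3 k4 (s4 - s3) + K k1 k3 (s3 - s1) * K k2 k4 (s4 - s2) +
      K k1 k4 (s4 - s1) * K k2 k3 (s3 - s2)"
    using I(2) unfolding stationary_gaussian_fieldD(3)[OF F] .
qed

lemma field_integrable_mult:
  assumes F: "stationary_gaussian_field M Z K" and P: "prob_space M"
  shows "integrable M (\<lambda>\<omega>. Z k s \<omega> * Z l t \<omega>)"
proof -
  note G = integrable_centered_gaussian_power(1)
    [OF field_combination_gaussian[OF F] P field_combination_centered[OF F P], of _ k s _ l t 0 k s 0 k s 2]
  have "Z k s \<omega> * Z l t \<omega> = ((1 * Z k s \<omega> + 1 * Z l t \<omega> + 0 * Z k s \<omega> + 0 * Z k s \<omega>)\<^sup>2 -
      (1 * Z k s \<omega> + (-1) * Z l t \<omega> + 0 * Z k s \<omega> + 0 * Z k s \<omega>)\<^sup>2) / 4" for \<omega>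
    by (simp add: power2_eq_square algebra_simps)
  then show ?thesis
    using G[of 1 1] G[of 1 "-1"] by (simp only:) (intro integrable_divide_zero Bochner_Integration.integrable_diff)
qed

lemma field_square_combination:
  assumes F: "stationary_gaussian_field M Z K" and P: "prob_space M"
  shows "integrable M (\<lambda>\<omega>. (p * Z k s \<omega> + q * Z k t \<omega>)\<^sup>2)"
    and "(\<integral>\<omega>. (p * Z k s \<omega> + q * Z k t \<omega>)\<^sup>2 \<partial>M) = (p\<^sup>2 + q\<^sup>2) * K k k 0 + 2 * p * q * K k k (t - s)"
proof -
  have *: "(p * Z k s \<omega> + q * Z k t \<omega>)\<^sup>2 =
      p\<^sup>2 * (Z k s \<omega> * Z k s \<omega>) + q\<^sup>2 * (Z k t \<omega> * Z k t \<omega>) + 2 * p * q * (Z k s \<omega> * Z k t \<omega>)" for \<omega>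
    by (simp add: power2_eq_square algebra_simps)
  show "integrable M (\<lambda>\<omega>. (p * Z k s \<omega> + q * Z k t \<omega>)\<^sup>2)"
    unfolding * using field_integrable_mult[OF F P] by auto
  show "(\<integral>\<omega>. (p * Z k s \<omega> + q * Z k t \<omega>)\<^sup>2 \<partial>M) = (p\<^sup>2 + q\<^sup>2) * K k k 0 + 2 * p * q * K k k (t - s)"
    unfolding * by (simp add: field_integrable_mult[OF F P] stationary_gaussian_fieldD(3)[OF F])
      (simp add: algebra_simps)
qed

lemma field_combination_AE_zero:
  assumes F: "stationary_gaussian_field M Z K" and P: "prob_space M"
    and "(p\<^sup>2 + q\<^sup>2) * K k k 0 + 2 * p * q * K k k (t - s) = 0"
  shows "AE \<omega> in M. p * Z k s \<omega> + q * Z k t \<omega> = 0"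
proof -
  have "AE \<omega> in M. (p * Z k s \<omega> + q * Z k t \<omega>)\<^sup>2 = 0"
    using field_square_combination[OF F P, of p k s q t] assms(3)
    by (subst integral_nonneg_eq_0_iff_AE[symmetric]) auto
  then show ?thesis by simp
qed

lemma field_variance_bounds:
  assumes F: "stationary_gaussian_field M Z K" and P: "prob_space M"
  shows "0 \<le> K k k 0" "\<bar>K k k t\<bar> \<le> K k k 0"
proof -
  have nn: "0 \<le> (p\<^sup>2 + q\<^sup>2) * K k k 0 + 2 * p * q * K k k t" for p q
  proof -
    have "0 \<le> (\<integral>\<omega>. (p * Z k 0 \<omega> + q * Z k t \<omega>)\<^sup>2 \<partial>M)" by simp
    then show ?thesis unfolding field_square_combination(2)[OF F P] by simp
  qed
  show "0 \<le> K k k 0" using nn[of 1 0] by simp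
  show "\<bar>K k k t\<bar> \<le> K k k 0" using nn[of 1 1] nn[of 1 "-1"] by simp
qed

text \<open>The second moment of the boundary term is 2 (ab + xy) plus nonnegative squares, where a,
  b are the variances and x, y the autocovariances at lag L. As |x| \<le> a and |y| \<le> b,
  vanishing forces xy = -ab. For positive variances this is equality in Cauchy-Schwarz with opposite
  signs, so a shift by \<open>L\<close> preserves the law but reverses the cross-covariance.\<close>

lemma cross_covariance_zero_if_boundary_null:
  assumes F: "stationary_gaussian_field M Z K" and P: "prob_space M"
    and even: "K k l (- L) = K k l L"
    and null: "AE \<omega> in M. Z k 0 \<omega> * Z l 0 \<omega> + Z k L \<omega> * Z l L \<omega> = 0"
  shows "K k l t = 0"
proof -
  interpret prob_space M by fact
  note cov = stationary_gaussian_fieldD(3)[OF F]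
  have [measurable]: "Z k s \<in> borel_measurable M" for k s
    using field_gaussian[OF F] by (auto simp: gaussian_rv_def)
  define a b x y where "a = K k k 0" and "b = K l l 0" and "x = K k k L" and "y = K l l L"
  have sym: "K l k u = K k l (- u)" for u
    using cov[of l 0 k u] cov[of k u l 0] by (simp add: mult.commute)
  have bounds: "0 \<le> a" "0 \<le> b" "\<bar>x\<bar> \<le> a" "\<bar>y\<bar> \<le> b"
    using field_variance_bounds[OF F P] by (auto simp: a_def b_def x_def y_def)
  let ?Q = "\<lambda>\<omega>. Z k 0 \<omega> * Z l 0 \<omega> * Z k 0 \<omega> * Z l 0 \<omega> + Z k L \<omega> * Z l L \<omega> * Z k L \<omega> * Z l L \<omega> +
      2 * (Z k 0 \<omega> * Z l 0 \<omega> * Z k L \<omega> * Z l L \<omega>)"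
  have "AE \<omega> in M. ?Q \<omega> = 0"
    using null
  proof eventually_elim
    case (elim \<omega>)
    have "?Q \<omega> = (Z k 0 \<omega> * Z l 0 \<omega> + Z k L \<omega> * Z l L \<omega>)\<^sup>2"
      by (simp add: power2_eq_square algebra_simps)
    with elim show ?case by simp
  qed
  then have "(\<integral>\<omega>. ?Q \<omega> \<partial>M) = 0"
    by (rule integral_eq_zero_AE)
  \<comment> \<open>Evenness of the cross-covariance at lag L turns the product
    \<open>K k l L * K l k L\<close> into a square.\<close>
  moreover have "(\<integral>\<omega>. ?Q \<omega> \<partial>M) = 2 * (a * b + x * y + 3 * (K k l 0)\<^sup>2 + (K k l L)\<^sup>2)"
    by (simp add: field_isserlis[OF F P] sym even a_def b_def x_def y_def)
      (simp add: power2_eq_square algebra_simps)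
  ultimately have "a * b + x * y + 3 * (K k l 0)\<^sup>2 + (K k l L)\<^sup>2 = 0" by simp
  then have le: "a * b + x * y \<le> 0"
    using zero_le_power2[of "K k l 0"] zero_le_power2[of "K k l L"] by linarith
  consider "a = 0" | "b = 0" | "a > 0" "b > 0" using bounds by linarith
  then show ?thesis
  proof cases
    case 1
    then have "AE \<omega> in M. Z k 0 \<omega> = 0"
      using field_combination_AE_zero[OF F P, of 1 0 k 0 0] by (simp add: a_def)
    then have "AE \<omega> in M. Z k 0 \<omega> * Z l t \<omega> = 0" by eventually_elim simp
    then have "(\<integral>\<omega>. Z k 0 \<omega> * Z l t \<omega> \<partial>M) = 0" by (rule integral_eq_zero_AE)
    then show ?thesis by (simp add: cov)
  next
    case 2
    then have "AE \<omega> in M. Z l t \<omega> = 0"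
      using field_combination_AE_zero[OF F P, of 1 0 l t t] by (simp add: b_def)
    then have "AE \<omega> in M. Z k 0 \<omega> * Z l t \<omega> = 0" by eventually_elim simp
    then have "(\<integral>\<omega>. Z k 0 \<omega> * Z l t \<omega> \<partial>M) = 0" by (rule integral_eq_zero_AE)
    then show ?thesis by (simp add: cov)
  next
    case 3
    have "a * b \<le> \<bar>x\<bar> * \<bar>y\<bar>"
      using le abs_ge_minus_self[of "x * y"] by (simp only: abs_mult)
    moreover have "\<bar>x\<bar> * \<bar>y\<bar> \<le> \<bar>x\<bar> * b" "\<bar>x\<bar> * \<bar>y\<bar> \<le> a * \<bar>y\<bar>"
      using bounds by (auto intro: mult_left_mono mult_right_mono)
    ultimately have "a * b \<le> \<bar>x\<bar> * b" "a * b \<le> a * \<bar>y\<bar>" by auto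
    with 3 bounds have abs: "\<bar>x\<bar> = a" "\<bar>y\<bar> = b" by auto
    have "x * y < 0" using le mult_pos_pos[OF 3] by linarith
    then have "x = a \<and> y = - b \<or> x = - a \<and> y = b"
      using abs by (cases "x < 0"; cases "y < 0") (auto simp: mult_less_0_iff)
    then obtain e where e: "e\<^sup>2 = 1" "x = e * a" "y = - e * b"
      using that[of 1] that[of "-1"] by auto
    \<comment> \<open>The variance of this combination is 2 a - 2 e x = 0; for the next one it is 2
      b + 2 e y = 0.\<close>
    have "AE \<omega> in M. (- e) * Z k 0 \<omega> + 1 * Z k L \<omega> = 0"
      by (rule field_combination_AE_zero[OF F P])
        (use e in \<open>simp add: power2_eq_square algebra_simps flip: a_def x_def\<close>)
    moreover have "AE \<omega> in M. e * Z l t \<omega> + 1 * Z l (t + L) \<omega> = 0"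
      by (rule field_combination_AE_zero[OF F P])
        (use e in \<open>simp add: power2_eq_square algebra_simps flip: b_def y_def\<close>)
    ultimately have ae: "AE \<omega> in M. Z k L \<omega> * Z l (t + L) \<omega> = - (Z k 0 \<omega> * Z l t \<omega>)"
    proof eventually_elim
      case (elim \<omega>)
      then have "Z k L \<omega> = e * Z k 0 \<omega>" "Z l (t + L) \<omega> = - e * Z l t \<omega>" by auto
      then have "Z k L \<omega> * Z l (t + L) \<omega> = - (e\<^sup>2 * (Z k 0 \<omega> * Z l t \<omega>))"
        by (simp add: power2_eq_square)
      with e(1) show ?case by simp
    qed
    have "K k l t = (\<integral>\<omega>. Z k L \<omega> * Z l (t + L) \<omega> \<partial>M)" by (simp add: cov)
    also have "\<dots> = (\<integral>\<omega>. - (Z k 0 \<omega> * Z l t \<omega>) \<partial>M)"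
      by (rule integral_cong_AE) (use ae in auto)
    also have "\<dots> = - K k l t" by (simp add: cov)
    finally show ?thesis by simp
  qed
qed

section \<open>Mean of the denominator\<close>

lemma integral_ou_form:
  assumes F: "stationary_gaussian_field M Z K" and P: "prob_space M"
  shows "integrable M (\<lambda>\<omega>. ou_form r n (\<lambda>i. Z k (grid L n i) \<omega>) (\<lambda>i. Z k (grid L n i) \<omega>))"
    and "(\<integral>\<omega>. ou_form r n (\<lambda>i. Z k (grid L n i) \<omega>) (\<lambda>i. Z k (grid L n i) \<omega>) \<partial>M) =
      K k k 0 + real n * ((1 + r\<^sup>2) * K k k 0 - 2 * r * K k k (L / real n)) / (1 - r\<^sup>2)"
proof -
  have step: "grid L n i - grid L n (Suc i) = - (L / real n)" for i
    by (simp add: grid_def algebra_simps add_divide_distrib)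
  have sym: "K k k (- u) = K k k u" for u
    using stationary_gaussian_fieldD(3)[OF F, of k 0 k u] stationary_gaussian_fieldD(3)[OF F, of k u k 0]
    by (simp add: mult.commute)
  have form: "ou_form r n (\<lambda>i. Z k (grid L n i) \<omega>) (\<lambda>i. Z k (grid L n i) \<omega>) =
      Z k (grid L n 0) \<omega> * Z k (grid L n 0) \<omega> +
      (\<Sum>i<n. (1 * Z k (grid L n (Suc i)) \<omega> + (- r) * Z k (grid L n i) \<omega>)\<^sup>2) / (1 - r\<^sup>2)" for \<omega>
    by (simp add: ou_form_def power2_eq_square)
  note sq = field_square_combination[OF F P, of 1 k _ "- r"]
  show "integrable M (\<lambda>\<omega>. ou_form r n (\<lambda>i. Z k (grid L n i) \<omega>) (\<lambda>i. Z k (grid L n i) \<omega>))"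
    unfolding form using field_integrable_mult[OF F P] sq(1)
    by (intro Bochner_Integration.integrable_add integrable_divide_zero Bochner_Integration.integrable_sum) auto
  have "(\<integral>\<omega>. ou_form r n (\<lambda>i. Z k (grid L n i) \<omega>) (\<lambda>i. Z k (grid L n i) \<omega>) \<partial>M) =
      (\<integral>\<omega>. Z k (grid L n 0) \<omega> * Z k (grid L n 0) \<omega> \<partial>M) +
      (\<Sum>i<n. \<integral>\<omega>. (1 * Z k (grid L n (Suc i)) \<omega> + (- r) * Z k (grid L n i) \<omega>)\<^sup>2 \<partial>M) / (1 - r\<^sup>2)"
    unfolding form
    by (subst Bochner_Integration.integral_add) (use field_integrable_mult[OF F P] sq(1) in
      \<open>auto intro!: integrable_divide_zero Bochner_Integration.integrable_sum simp: Bochner_Integration.integral_sum\<close>)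
  also have "\<dots> = K k k 0 + (\<Sum>i<n. (1 + r\<^sup>2) * K k k 0 - 2 * r * K k k (L / real n)) / (1 - r\<^sup>2)"
    unfolding sq(2) by (simp add: stationary_gaussian_fieldD(3)[OF F] step sym)
  finally show "(\<integral>\<omega>. ou_form r n (\<lambda>i. Z k (grid L n i) \<omega>) (\<lambda>i. Z k (grid L n i) \<omega>) \<partial>M) =
      K k k 0 + real n * ((1 + r\<^sup>2) * K k k 0 - 2 * r * K k k (L / real n)) / (1 - r\<^sup>2)" by simp
qed

lemma filterlim_step_at_right:
  assumes "L > 0"
  shows "filterlim (\<lambda>n. L / real n) (at_right 0) sequentially"
  using assms by real_asymp

text \<open>The expected squared prediction error is (1 - r)^2 K(0) + 2 r (K(0) - K(h)) = O(h^2),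
  and 1 - r^2 is at least lam h. Each of the n = L / h terms is therefore O(h), so the sum stays
  bounded.\<close>

lemma integral_ou_form_bounded:
  assumes F: "stationary_gaussian_field M Z K" and P: "prob_space M"
    and L: "L > 0" and lam: "lam > 0"
    and quad: "\<forall>\<^sub>F t in at_right 0. \<bar>K k k 0 - K k k t\<bar> \<le> C * t\<^sup>2"
  shows "\<forall>\<^sub>F n in sequentially.
    (\<integral>\<omega>. ou_form (exp (- lam * (L / real n))) n (\<lambda>i. Z k (grid L n i) \<omega>) (\<lambda>i. Z k (grid L n i) \<omega>) \<partial>M) \<le>
      K k k 0 + (lam\<^sup>2 * K k k 0 + 2 * C) * L / lam"
proof -
  have "\<forall>\<^sub>F n in sequentially. \<bar>K k k 0 - K k k (L / real n)\<bar> \<le> C * (L / real n)\<^sup>2"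
    using filterlim_step_at_right[OF L] quad unfolding filterlim_iff by blast
  \<comment> \<open>With s = lam h, the bound exp (-2 s) \<le> 1 / (1 + 2 s) \<le> 1 - s used for
    the denominator holds for 0 \<le> s \<le> 1/2.\<close>
  moreover have "\<forall>\<^sub>F n in sequentially. L / real n \<in> {0<..<1 / (2 * lam)}"
    by (rule eventually_compose_filterlim[OF eventually_at_right_real filterlim_step_at_right[OF L]])
      (use lam in simp)
  ultimately show ?thesis
  proof eventually_elim
    case (elim n)
    define h r K0 where "h = L / real n" and "r = exp (- lam * h)" and "K0 = K k k 0"
    have h: "0 < h" "lam * h \<le> 1 / 2" using elim(2) lam by (auto simp: h_def field_simps)
    have K0: "0 \<le> K0" using field_variance_bounds[OF F P] by (simp add: K0_def)
    have r: "0 < r" "r < 1" "1 - r \<le> lam * h"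
      using h lam exp_ge_add_one_self[of "- lam * h"] by (auto simp: r_def)
    have "r\<^sup>2 = exp (- (2 * (lam * h)))" by (simp add: r_def power2_eq_square flip: exp_add)
    also have "\<dots> = 1 / exp (2 * (lam * h))" by (simp add: exp_minus inverse_eq_divide)
    also have "\<dots> \<le> 1 / (1 + 2 * (lam * h))"
      using h lam by (intro divide_left_mono exp_ge_add_one_self mult_pos_pos add_pos_pos) auto
    also have "\<dots> \<le> 1 - lam * h"
    proof -
      have "0 \<le> (lam * h) * (1 - 2 * (lam * h))" using h lam by (intro mult_nonneg_nonneg) auto
      then have "1 \<le> (1 - lam * h) * (1 + 2 * (lam * h))" by (simp add: algebra_simps)
      moreover have "0 < 1 + 2 * (lam * h)" using h lam by (intro add_pos_pos mult_pos_pos) auto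
      ultimately show ?thesis by (simp only: pos_divide_le_eq)
    qed
    finally have den: "lam * h \<le> 1 - r\<^sup>2" by simp
    have C: "0 \<le> C * h\<^sup>2" using elim(1) by (simp add: h_def)
    have "(1 + r\<^sup>2) * K0 - 2 * r * K k k h = (1 - r)\<^sup>2 * K0 + 2 * r * (K0 - K k k h)"
      by (simp add: power2_eq_square algebra_simps)
    also have "\<dots> \<le> (lam * h)\<^sup>2 * K0 + 2 * 1 * (C * h\<^sup>2)"
    proof (rule add_mono)
      show "(1 - r)\<^sup>2 * K0 \<le> (lam * h)\<^sup>2 * K0" using r K0 by (intro mult_right_mono power_mono) auto
      have "2 * r * (K0 - K k k h) \<le> 2 * r * (C * h\<^sup>2)"
        using elim(1) r by (intro mult_left_mono) (auto simp: h_def K0_def)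
      also have "\<dots> \<le> 2 * 1 * (C * h\<^sup>2)" using r C by (intro mult_right_mono) auto
      finally show "2 * r * (K0 - K k k h) \<le> 2 * 1 * (C * h\<^sup>2)" .
    qed
    also have "\<dots> = (lam\<^sup>2 * K0 + 2 * C) * h\<^sup>2" by (simp add: power2_eq_square algebra_simps)
    finally have num: "(1 + r\<^sup>2) * K0 - 2 * r * K k k h \<le> (lam\<^sup>2 * K0 + 2 * C) * h\<^sup>2" .
    have "0 \<le> (lam\<^sup>2 * K0 + 2 * C) * h\<^sup>2" using C K0 by (simp add: distrib_right)
    then have "((1 + r\<^sup>2) * K0 - 2 * r * K k k h) / (1 - r\<^sup>2) \<le> (lam\<^sup>2 * K0 + 2 * C) * h\<^sup>2 / (lam * h)"
      using num den h lam by (intro frac_le) auto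
    also have "\<dots> = (lam\<^sup>2 * K0 + 2 * C) * h / lam" using h by (simp add: power2_eq_square)
    finally have "real n * (((1 + r\<^sup>2) * K0 - 2 * r * K k k h) / (1 - r\<^sup>2)) \<le>
        real n * ((lam\<^sup>2 * K0 + 2 * C) * h / lam)" by (rule mult_left_mono) simp
    also have "\<dots> = (lam\<^sup>2 * K0 + 2 * C) * L / lam"
      using elim(2) by (cases "n = 0") (simp_all add: h_def)
    finally show ?case
      unfolding integral_ou_form(2)[OF F P] by (simp add: r_def h_def K0_def)
  qed
qed

section \<open>Elimination and conclusion\<close>

text \<open>Cramer's rule: three rates give three linear equations for the sum of products, the sum
  of products of increments and the boundary term. Solving for the last, numerator weights and
  determinant are all controlled at order h^3, so their quotients stay bounded and \<open>C\<close>
  is uniform in \<open>n\<close>, \<open>x\<close>, \<open>w\<close>.\<close>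

lemma boundary_term_elimination:
  assumes "l1 > 0" "l2 > 0" "l3 > 0" "l1 \<noteq> l2" "l1 \<noteq> l3" "l2 \<noteq> (l3::real)"
  obtains C where "\<forall>\<^sub>F h in at_right 0. \<forall>n x w. \<bar>x 0 * w 0 + x n * w n\<bar> \<le>
    C * (\<Sum>l\<in>{l1, l2, l3}. \<bar>ou_form (exp (- l * h)) n x w\<bar>)"
proof -
  define r where "r l h = exp (- l * h)" for l h :: real
  \<comment> \<open>Dividing the decomposition by \<open>r\<close> normalises the coefficient of the
    increment sum to 1.\<close>
  define u where "u l h = (1 - (r l h)\<^sup>2) / r l h" for l h
  define v where "v l h = (1 - r l h)\<^sup>2 / r l h" for l h
  define \<kappa> where "\<kappa> h = (r l2 h - r l1 h) * (v l1 h - v l3 h) - (r l3 h - r l1 h) * (v l1 h - v l2 h)" for h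
  \<comment> \<open>Apart from the factors \<open>u\<close>, these are cofactors: with signs +, -, +
    they annihilate the constant column and the column of the \<open>v\<close>, leaving \<kappa> as
    the coefficient of the boundary term.\<close>
  define w1 w2 w3 where "w1 h = u l1 h * (v l2 h - v l3 h)" and "w2 h = u l2 h * (v l1 h - v l3 h)"
    and "w3 h = u l3 h * (v l1 h - v l2 h)" for h
  have lims: "((\<lambda>h. (1 - r l h) / h) \<longlongrightarrow> l) (at_right 0)" "((\<lambda>h. u l h / h) \<longlongrightarrow> 2 * l) (at_right 0)"
    "((\<lambda>h. v l h / h\<^sup>2) \<longlongrightarrow> l\<^sup>2) (at_right 0)" if "l > 0" for l
    using that unfolding u_def v_def r_def by real_asymp+
  note L1 = lims[OF assms(1)] and L2 = lims[OF assms(2)] and L3 = lims[OF assms(3)]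
  define k where "k = (l1 - l2) * (l1\<^sup>2 - l3\<^sup>2) - (l1 - l3) * (l1\<^sup>2 - l2\<^sup>2)"
  \<comment> \<open>\<open>\<kappa>\<close> is a determinant that degenerates, at order \<open>h\<^sup>3\<close>, to a Vandermonde determinant.\<close>
  have "k = (l1 - l2) * (l1 - l3) * (l3 - l2)"
    by (simp add: k_def power2_eq_square algebra_simps)
  then have k: "k \<noteq> 0" using assms by simp
  have near: "\<forall>\<^sub>F h in at_right 0. h \<in> {0<..<1::real}"
    by (intro eventually_at_right_real) simp
  have "((\<lambda>h. ((1 - r l1 h) / h - (1 - r l2 h) / h) * (v l1 h / h\<^sup>2 - v l3 h / h\<^sup>2) -
      ((1 - r l1 h) / h - (1 - r l3 h) / h) * (v l1 h / h\<^sup>2 - v l2 h / h\<^sup>2)) \<longlongrightarrow> k) (at_right 0)"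
    unfolding k_def by (intro tendsto_intros L1 L2 L3)
  then have lim\<kappa>: "((\<lambda>h. \<kappa> h / h ^ 3) \<longlongrightarrow> k) (at_right 0)"
    by (rule Lim_transform_eventually)
      (use near in eventually_elim, simp add: \<kappa>_def power2_eq_square power3_eq_cube field_simps)
  have limw: "((\<lambda>h. u a h * (v b h - v c h) / h ^ 3) \<longlongrightarrow> 2 * a * (b\<^sup>2 - c\<^sup>2)) (at_right 0)"
    if "a > 0" "b > 0" "c > 0" for a b c
  proof -
    have "((\<lambda>h. u a h / h * (v b h / h\<^sup>2 - v c h / h\<^sup>2)) \<longlongrightarrow> 2 * a * (b\<^sup>2 - c\<^sup>2)) (at_right 0)"
      using that by (intro tendsto_intros lims)
    then show ?thesis
      by (rule Lim_transform_eventually)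
        (use near in eventually_elim, simp add: power2_eq_square power3_eq_cube diff_divide_distrib right_diff_distrib)
  qed
  have bound: "\<exists>B\<ge>0. \<forall>\<^sub>F h in at_right 0. \<bar>f h / \<kappa> h\<bar> \<le> B"
    if "((\<lambda>h. f h / h ^ 3) \<longlongrightarrow> z) (at_right 0)" for f z
  proof -
    have "((\<lambda>h. \<bar>f h / h ^ 3 / (\<kappa> h / h ^ 3)\<bar>) \<longlongrightarrow> \<bar>z / k\<bar>) (at_right 0)"
      by (intro tendsto_intros that lim\<kappa> k)
    then have "\<forall>\<^sub>F h in at_right 0. \<bar>f h / h ^ 3 / (\<kappa> h / h ^ 3)\<bar> < \<bar>z / k\<bar> + 1"
      by (rule order_tendstoD) simp
    with near have "\<forall>\<^sub>F h in at_right 0. \<bar>f h / \<kappa> h\<bar> \<le> \<bar>z / k\<bar> + 1"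
      by eventually_elim simp
    then show ?thesis by (intro exI[of _ "\<bar>z / k\<bar> + 1"]) auto
  qed
  obtain B1 where B1: "B1 \<ge> 0" "\<forall>\<^sub>F h in at_right 0. \<bar>w1 h / \<kappa> h\<bar> \<le> B1"
    using bound[OF limw[OF assms(1) assms(2) assms(3)]] by (auto simp: w1_def)
  obtain B2 where B2: "B2 \<ge> 0" "\<forall>\<^sub>F h in at_right 0. \<bar>w2 h / \<kappa> h\<bar> \<le> B2"
    using bound[OF limw[OF assms(2) assms(1) assms(3)]] by (auto simp: w2_def)
  obtain B3 where B3: "B3 \<ge> 0" "\<forall>\<^sub>F h in at_right 0. \<bar>w3 h / \<kappa> h\<bar> \<le> B3"
    using bound[OF limw[OF assms(3) assms(1) assms(2)]] by (auto simp: w3_def)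
  define C where "C = B1 + B2 + B3"
  have "\<forall>\<^sub>F h in at_right 0. \<kappa> h / h ^ 3 \<noteq> 0"
    by (rule tendsto_imp_eventually_ne[OF lim\<kappa> k])
  with near B1(2) B2(2) B3(2)
  have "\<forall>\<^sub>F h in at_right 0. \<forall>n x w. \<bar>x 0 * w 0 + x n * w n\<bar> \<le>
    C * (\<Sum>l\<in>{l1, l2, l3}. \<bar>ou_form (exp (- l * h)) n x w\<bar>)"
  proof eventually_elim
    case (elim h)
    show ?case
    proof (intro allI)
      fix n and x w :: "nat \<Rightarrow> real"
      define S D Q where "S = (\<Sum>i\<le>n. x i * w i)" and "D = (\<Sum>i<n. (x (Suc i) - x i) * (w (Suc i) - w i))"
        and "Q = x 0 * w 0 + x n * w n"
      define N where "N l = ou_form (r l h) n x w" for l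
      have form: "u l h * N l = v l h * S + D + (1 - r l h) * Q" if "l > 0" for l
      proof -
        have r: "0 < r l h" "r l h < 1" using that elim(1) by (auto simp: r_def)
        then have "(r l h)\<^sup>2 \<noteq> 1" using power2_eq_1_iff[of "r l h"] by simp
        from ou_form_decomposition[OF this, of n x w]
        have "(1 - (r l h)\<^sup>2) * N l = (1 - r l h)\<^sup>2 * S + r l h * D + r l h * (1 - r l h) * Q"
          by (simp add: N_def S_def D_def Q_def)
        then show ?thesis using r by (simp add: u_def v_def field_simps)
      qed
      have "\<kappa> h * Q = w1 h * N l1 - w2 h * N l2 + w3 h * N l3"
      proof -
        have "w1 h * N l1 - w2 h * N l2 + w3 h * N l3 =
            (v l2 h - v l3 h) * (u l1 h * N l1) - (v l1 h - v l3 h) * (u l2 h * N l2) +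
            (v l1 h - v l2 h) * (u l3 h * N l3)"
          by (simp add: w1_def w2_def w3_def mult_ac)
        also have "\<dots> = \<kappa> h * Q"
          unfolding form[OF assms(1)] form[OF assms(2)] form[OF assms(3)] \<kappa>_def
          by (simp add: algebra_simps)
        finally show ?thesis by simp
      qed
      then have "Q = w1 h / \<kappa> h * N l1 - w2 h / \<kappa> h * N l2 + w3 h / \<kappa> h * N l3"
        using elim(5) by (simp add: field_simps)
      then have "\<bar>Q\<bar> \<le> \<bar>w1 h / \<kappa> h\<bar> * \<bar>N l1\<bar> + \<bar>w2 h / \<kappa> h\<bar> * \<bar>N l2\<bar> + \<bar>w3 h / \<kappa> h\<bar> * \<bar>N l3\<bar>"
        unfolding abs_mult[symmetric] by linarith
      also have "\<dots> \<le> C * \<bar>N l1\<bar> + C * \<bar>N l2\<bar> + C * \<bar>N l3\<bar>"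
        using elim(2-4) B1(1) B2(1) B3(1) by (intro add_mono mult_right_mono) (auto simp: C_def)
      finally show "\<bar>x 0 * w 0 + x n * w n\<bar> \<le> C * (\<Sum>l\<in>{l1, l2, l3}. \<bar>ou_form (exp (- l * h)) n x w\<bar>)"
        using assms(4-6) by (simp add: Q_def N_def r_def algebra_simps)
    qed
  qed
  then show thesis by (rule that)
qed

section \<open>Counting the exceptional parameters\<close>

lemma tendsto_in_prob_cong:
  assumes "\<forall>\<^sub>F n in sequentially. \<forall>\<omega>. T n \<omega> = T' n \<omega>"
  shows "tendsto_in_prob M T b \<longleftrightarrow> tendsto_in_prob M T' b"
  unfolding tendsto_in_prob_def
  by (intro all_cong1 imp_cong refl tendsto_cong) (use assms in eventually_elim, simp)

lemma finite_card_le_2I: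
  assumes "\<And>x y z. x \<in> S \<Longrightarrow> y \<in> S \<Longrightarrow> z \<in> S \<Longrightarrow> x \<noteq> y \<Longrightarrow> x \<noteq> z \<Longrightarrow> y \<noteq> z \<Longrightarrow> False"
  shows "finite S \<and> card S \<le> 2"
proof (rule ccontr)
  assume "\<not> (finite S \<and> card S \<le> 2)"
  then obtain T where "T \<subseteq> S" "card T = 3"
    by (metis infinite_arbitrarily_large obtain_subset_with_card_n not_less_eq_eq numeral_2_eq_2 numeral_3_eq_3)
  then show False using assms unfolding card_3_iff by blast
qed

theorem propositionS1:
  fixes M :: "'a measure"
    and X W Y :: "real \<Rightarrow> 'a \<Rightarrow> real"
    and K :: "2 \<Rightarrow> 2 \<Rightarrow> real \<Rightarrow> real"
    and c \<alpha> :: "2 \<Rightarrow> 2 \<Rightarrow> real"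
    and L \<beta> :: real
  assumes "prob_space M"
    and "stationary_gaussian_field M (\<lambda>k::2. if k = 1 then X else W) K"
    and "L > 0"
    and "\<And>k l. cond_A L (c k l) (\<alpha> k l) (K k l)"
    and "\<And>k. c k k \<noteq> 0"
    and "c 1 2 \<noteq> 0"
    and "\<alpha> 1 2 > \<alpha> 1 1"
    and "\<alpha> 1 1 < \<alpha> 2 2 + 1"
    and "\<And>s \<omega>. Y s \<omega> = X s \<omega> * \<beta> + W s \<omega>"
    and "\<alpha> 1 1 > 2"
  shows "\<exists>S. S \<subseteq> {0<..} \<and> finite S \<and> card S \<le> 12 \<and>
    (\<forall>lam\<in>{0<..} - S.
       \<not> tendsto_in_prob M
           (\<lambda>n \<omega>. gls (exp_cov_mat L n lam) (grid_vec L n X \<omega>) (grid_vec L n Y \<omega>)) \<beta>)"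
proof -
  note P = assms(1) and F = assms(2) and L = assms(3)
  define est where "est lam n \<omega> = gls (exp_cov_mat L n lam) (grid_vec L n X \<omega>) (grid_vec L n Y \<omega>)"
    for lam n \<omega>
  define N where "N lam n \<omega> = ou_form (exp (- lam * (L / real n))) n (\<lambda>i. X (grid L n i) \<omega>) (\<lambda>i. W (grid L n i) \<omega>)"
    for lam n \<omega>
  \<comment> \<open>The exceptional set is exactly the set of rates with consistency, so only its
    size has to be bounded.\<close>
  define S where "S = {lam. lam > 0 \<and> tendsto_in_prob M (est lam) \<beta>}"
  have [measurable]: "X s \<in> borel_measurable M" "W s \<in> borel_measurable M" for s
    using field_gaussian[OF F, of 1 s] field_gaussian[OF F, of 2 s] by (auto simp: gaussian_rv_def)
  have "Y s = (\<lambda>\<omega>. X s \<omega> * \<beta> + W s \<omega>)" for s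
    using assms(9) by blast
  then have [measurable]: "Y s \<in> borel_measurable M" for s by simp
  obtain C where quad: "\<forall>\<^sub>F t in at_right 0. \<bar>K 1 1 0 - K 1 1 t\<bar> \<le> C * t\<^sup>2"
    using cond_A_quadratic[OF assms(4) L assms(10)] by blast
  have pos: "\<forall>\<^sub>F n in sequentially. n > (0::nat)" by (rule eventually_gt_at_top)
  have N: "tendsto_in_prob M (N lam) 0" if "lam \<in> S" for lam
  proof -
    have lam: "lam > 0" and est: "tendsto_in_prob M (est lam) \<beta>" using that by (auto simp: S_def)
    define r where "r n = exp (- lam * (L / real n))" for n
    \<comment> \<open>For \<open>n = 0\<close> the step \<open>L / real n\<close> is 0 in HOL, hence
      \<open>r 0 = 1\<close>; the strict bound starts at n = 1, whereas nonnegativity of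
      \<open>D n\<close> is required for every \<open>n\<close>.\<close>
    have r: "(r n)\<^sup>2 \<le> 1" "n > 0 \<Longrightarrow> (r n)\<^sup>2 < 1" for n
    proof -
      have "0 \<le> r n" "r n \<le> 1" using lam L by (simp_all add: r_def)
      then show "(r n)\<^sup>2 \<le> 1" by (rule power_le_one)
      assume "n > 0"
      then have "r n < 1" using lam L by (simp add: r_def)
      with \<open>0 \<le> r n\<close> show "(r n)\<^sup>2 < 1" by (simp add: power2_less_1_iff)
    qed
    define D where "D n \<omega> = ou_form (r n) n (\<lambda>i. X (grid L n i) \<omega>) (\<lambda>i. X (grid L n i) \<omega>)" for n \<omega>
    define G where "G n \<omega> = ou_form (r n) n (\<lambda>i. X (grid L n i) \<omega>) (\<lambda>i. Y (grid L n i) \<omega>) / D n \<omega>" for n \<omega>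
    have "tendsto_in_prob M G \<beta> \<longleftrightarrow> tendsto_in_prob M (est lam) \<beta>"
      by (rule tendsto_in_prob_cong, use pos in eventually_elim)
        (simp add: G_def D_def est_def r_def gls_eq_ou_form L lam)
    with est have "tendsto_in_prob M G \<beta>" by simp
    then have "tendsto_in_prob M (\<lambda>n \<omega>. (G n \<omega> - \<beta>) * D n \<omega>) 0"
    proof (rule tendsto_in_prob_mult_bounded_mean[OF P, rotated 4])
      show "G n \<in> borel_measurable M" for n unfolding G_def D_def ou_form_def by measurable
      show "integrable M (D n)" for n
        using integral_ou_form(1)[OF F P, where r = "r n" and n = n and k = 1 and L = L] by (simp add: D_def[abs_def])
      show "0 \<le> D n \<omega>" for n \<omega> using ou_form_nonneg[OF r(1)] by (simp add: D_def)
      show "\<forall>\<^sub>F n in sequentially. (\<integral>\<omega>. D n \<omega> \<partial>M) \<le> K 1 1 0 + (lam\<^sup>2 * K 1 1 0 + 2 * C) * L / lam"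
        using integral_ou_form_bounded[OF F P L lam quad] by (simp add: D_def[abs_def] r_def)
    qed
    moreover have "tendsto_in_prob M (\<lambda>n \<omega>. (G n \<omega> - \<beta>) * D n \<omega>) 0 \<longleftrightarrow> tendsto_in_prob M (N lam) 0"
    proof (rule tendsto_in_prob_cong, use pos in eventually_elim)
      case (elim n)
      show ?case
        using ou_form_regression[OF r(2)[OF elim]] by (simp add: G_def D_def N_def r_def assms(9))
    qed
    ultimately show ?thesis by simp
  qed
  have "finite S \<and> card S \<le> 2"
  proof (rule finite_card_le_2I)
    fix l1 l2 l3 assume l: "l1 \<in> S" "l2 \<in> S" "l3 \<in> S" "l1 \<noteq> l2" "l1 \<noteq> l3" "l2 \<noteq> l3"
    then have pos_l: "l1 > 0" "l2 > 0" "l3 > 0" by (auto simp: S_def)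
    obtain C where "\<forall>\<^sub>F h in at_right 0. \<forall>n x w. \<bar>x 0 * w 0 + x n * w n\<bar> \<le>
        C * (\<Sum>l\<in>{l1, l2, l3}. \<bar>ou_form (exp (- l * h)) n x w\<bar>)"
      by (rule boundary_term_elimination[OF pos_l l(4-6)])
    then have "\<forall>\<^sub>F n in sequentially. \<forall>m x w. \<bar>x 0 * w 0 + x m * w m\<bar> \<le>
        C * (\<Sum>l\<in>{l1, l2, l3}. \<bar>ou_form (exp (- l * (L / real n))) m x w\<bar>)"
      by (rule eventually_compose_filterlim[OF _ filterlim_step_at_right[OF L]])
    with pos have dom: "\<forall>\<^sub>F n in sequentially. \<forall>\<omega>. \<bar>X 0 \<omega> * W 0 \<omega> + X L \<omega> * W L \<omega>\<bar> \<le>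
        C * (\<Sum>l\<in>{l1, l2, l3}. \<bar>N l n \<omega>\<bar>)"
    proof eventually_elim
      case (elim n)
      \<comment> \<open>The end points are 0 and \<open>L\<close> on every grid, so the boundary
        term does not change with \<open>n\<close>; this allows it to be dominated along the whole
        sequence.\<close>
      have "grid L n 0 = 0" "grid L n n = L" using elim(1) by (simp_all add: grid_def)
      then show ?case
        using elim(2)[rule_format, of "\<lambda>i. X (grid L n i) _" "\<lambda>i. W (grid L n i) _" n]
        by (simp only: N_def simp_thms)
    qed
    have "AE \<omega> in M. X 0 \<omega> * W 0 \<omega> + X L \<omega> * W L \<omega> = 0"
    proof (rule AE_zero_if_dominated[OF P _ _ _ _ dom])
      show "N l n \<in> borel_measurable M" for l n unfolding N_def ou_form_def by measurable
      show "tendsto_in_prob M (N l) 0" if "l \<in> {l1, l2, l3}" for l using that l N by auto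
    qed auto
    moreover have "K 1 2 (- L) = K 1 2 L"
      using L by (intro cond_A_even[OF assms(4)]) auto
    ultimately have "K 1 2 t = 0" for t
      using cross_covariance_zero_if_boundary_null[OF F P, of 1 2 L t] by simp
    then show False using cond_A_imp_nonzero[OF assms(4) L assms(6)] by blast
  qed
  then show ?thesis
    by (intro exI[of _ S]) (auto simp: S_def est_def[abs_def])
qed

end
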